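(* Let $n\ge 1$ and let $(G,x,y)$ be an $n$-isobicyclic triple. Then $(G,x,y)$ is isomorphic to a semidirect product of a $t$-isobicyclic triple $(T,x_T,y_T)$ by an $s$-isobicyclic triple $(S,x_S,y_S)$ (in the sense defined below), where (i) $n=st$ with $\gcd(s,t)=1$; (ii) $(S,x_S,y_S)$ is a cartesian product of $p_i^{e_i}$-isobicyclic triples for $i=1,\dots,k$, where $s=p_1^{e_1}\cdots p_k^{e_k}$ with the $p_i$ distinct primes; (iii) $(T,x_T,y_T)$ is the standard $t$-isobicyclic triple.
   Context: A group $G$ is $n$-isobicyclic if it has cyclic subgroups $X=\langle x\rangle$, $Y=\langle y\rangle$ of order $n$ with $G=XY$, $X\cap Y=1$, and there is an automorphism of $G$ transposing $x$ and $y$; $(G,x,y)$ is then an $n$-isobicyclic triple. Triples $(G,x,y)$, $(G',x',y')$ are isomorphic if some isomorphism $G\to G'$ sends $x\mapsto x'$, $y\mapsto y'$. The standard $t$-isobicyclic triple is $(T,x_T,y_T)$ with $T=\langle x_T,y_T\mid x_T^t=y_T^t=[x_T,y_T]=1\rangle\cong C_t\times C_t$. Cartesian product: if $(G_i,x_i,y_i)$ is $s_i$-isobicyclic ($i=1,\dots,k$) with the $s_i$ pairwise coprime, their cartesian product is $(G_1\times\cdots\times G_k,(x_1,\dots,x_k),(y_1,\dots,y_k))$, an $s_1\cdots s_k$-isobicyclic triple. Semidirect product: let $(S,x_S,y_S)$ be $s$-isobicyclic, $(T,x_T,y_T)$ the standard $t$-isobicyclic triple, $\gcd(s,t)=1$,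 and suppose there is $\lambda\in\mathbb Z_t^*$ and a homomorphism $\psi:S\to\mathrm{Aut}\,T$ with $x_T^{\psi(x_S)}=x_T$, $y_T^{\psi(x_S)}=y_T^{\lambda}$, $x_T^{\psi(y_S)}=x_T^{\lambda}$, $y_T^{\psi(y_S)}=y_T$ (a "diagonal action with eigenvalue $\lambda$"). Then with $G=T\rtimes_\psi S$, $x=x_Sx_T$, $y=y_Sy_T$, the triple $(G,x,y)$ is $st$-isobicyclic; it is called the semidirect product of $(T,x_T,y_T)$ by $(S,x_S,y_S)$ (with eigenvalue $\lambda$). *)

theory Defs
  imports "HOL-Algebra.Algebra" "HOL-Computational_Algebra.Primes"
begin

definition isobicyclic :: "nat \<Rightarrow> ('a, 'b) monoid_scheme \<Rightarrow> 'a \<Rightarrow> 'a \<Rightarrow> bool" where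
  "isobicyclic n G x y \<longleftrightarrow>
     group G \<and> x \<in> carrier G \<and> y \<in> carrier G \<and>
     group.ord G x = n \<and> group.ord G y = n \<and>
     carrier G = generate G {x} <#>\<^bsub>G\<^esub> generate G {y} \<and>
     generate G {x} \<inter> generate G {y} = {\<one>\<^bsub>G\<^esub>} \<and>
     (\<exists>\<phi>. \<phi> \<in> iso G G \<and> \<phi> x = y \<and> \<phi> y = x)"

definition triple_iso ::
  "('a, 'c) monoid_scheme \<Rightarrow> 'a \<Rightarrow> 'a \<Rightarrow> ('b, 'd) monoid_scheme \<Rightarrow> 'b \<Rightarrow> 'b \<Rightarrow> bool" where
  "triple_iso G x y H x' y' \<longleftrightarrow> (\<exists>\<phi>. \<phi> \<in> iso G H \<and> \<phi> x = x' \<and> \<phi> y = y')"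

definition std_T :: "nat \<Rightarrow> (nat \<times> nat) monoid" where
  "std_T t = \<lparr>carrier = {0..<t} \<times> {0..<t},
              monoid.mult = (\<lambda>(a, b) (c, d). ((a + c) mod t, (b + d) mod t)),
              one = (0, 0)\<rparr>"

definition std_x :: "nat \<Rightarrow> nat \<times> nat" where "std_x t = (1 mod t, 0)"
definition std_y :: "nat \<Rightarrow> nat \<times> nat" where "std_y t = (0, 1 mod t)"

text \<open>Semidirect product T \<rtimes>_psi S, with psi a homomorphism S \<rightarrow> Aut T where
  automorphisms act on the right (exponent notation a^(psi b) = psi b a, so
  a^(psi (b1 b2)) = (a^(psi b1))^(psi b2)).  The pair (b, a) stands for the
  product b a (b in S, a in T), and a b = b a^(psi b).\<close>
definition sdprod :: "('c, 'e) monoid_scheme \<Rightarrow> ('b, 'd) monoid_scheme \<Rightarrow> ('b \<Rightarrow> 'c \<Rightarrow> 'c)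
                        \<Rightarrow> ('b \<times> 'c) monoid" where
  "sdprod T S \<psi> = \<lparr>carrier = carrier S \<times> carrier T,
      monoid.mult = (\<lambda>(b1, a1) (b2, a2). (b1 \<otimes>\<^bsub>S\<^esub> b2, \<psi> b2 a1 \<otimes>\<^bsub>T\<^esub> a2)),
      one = (\<one>\<^bsub>S\<^esub>, \<one>\<^bsub>T\<^esub>)\<rparr>"

definition diagonal_action ::
  "('c, 'e) monoid_scheme \<Rightarrow> 'c \<Rightarrow> 'c \<Rightarrow> ('b, 'd) monoid_scheme \<Rightarrow> 'b \<Rightarrow> 'b
     \<Rightarrow> ('b \<Rightarrow> 'c \<Rightarrow> 'c) \<Rightarrow> nat \<Rightarrow> bool" where
  "diagonal_action T xT yT S xS yS \<psi> lam \<longleftrightarrow>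
     (\<forall>b \<in> carrier S. \<psi> b \<in> iso T T) \<and>
     (\<forall>b1 \<in> carrier S. \<forall>b2 \<in> carrier S. \<forall>a \<in> carrier T.
         \<psi> (b1 \<otimes>\<^bsub>S\<^esub> b2) a = \<psi> b2 (\<psi> b1 a)) \<and>
     \<psi> xS xT = xT \<and> \<psi> xS yT = yT [^]\<^bsub>T\<^esub> lam \<and>
     \<psi> yS xT = xT [^]\<^bsub>T\<^esub> lam \<and> \<psi> yS yT = yT"

end

theory Submission
  imports Defs "HOL-Number_Theory.Cong"
begin

text \<open>
  Write \<open>X = \<langle>x\<rangle>\<close>, \<open>Y = \<langle>y\<rangle>\<close> and \<open>z\<^bsup>g\<^esup> = g\<inverse>zg\<close>. By Ito's theorem \<open>N = G'\<close> is abelian. Fix a prime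
  \<open>p\<close> with \<open>p\<^bsup>a\<^esup>\<close> exactly dividing \<open>n\<close>, let \<open>M\<close> be the \<open>p\<close>-part of \<open>N\<close>, and let \<open>u = x\<^bsup>p^a\<^esup>\<close> and
  \<open>v = y\<^bsup>p^a\<^esup>\<close> generate the \<open>p'\<close>-parts of \<open>X\<close> and \<open>Y\<close>. A Hall--Witt argument gives \<open>[M,u,v] = 1\<close>. If
  \<open>u\<close> acts nontrivially on \<open>M\<close> (then so does \<open>v\<close>, and \<open>p\<close> is called active), comparing \<open>[M,u]\<close> and
  \<open>[M,v]\<close> with the cyclic \<open>p\<close>-parts of \<open>X\<close> and \<open>Y\<close> shows that \<open>[M,u]\<close> is the \<open>p\<close>-part of \<open>Y\<close> and
  \<open>[M,v]\<close> that of \<open>X\<close>. If \<open>u\<close> acts trivially, the \<open>p'\<close>-parts of \<open>X\<close> and \<open>Y\<close> multiply to a normal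
  \<open>p\<close>-complement of \<open>G\<close>.

  Let \<open>t\<close> be the part of \<open>n\<close> supported at the active primes and \<open>s = n/t\<close>. The quotients by the normal
  complements give a map from \<open>G\<close> onto a product of isobicyclic groups of prime power type, with kernel
  \<open>\<langle>x\<^bsup>s\<^esup>\<rangle>\<langle>y\<^bsup>s\<^esup>\<rangle>\<close>. The extension splits explicitly: with \<open>w = y\<^bsup>t\<^esup>\<close> the map
  \<open>g \<mapsto> [[g,w]\<^bsup>s^2\<^esup>,w]\<close> is a crossed homomorphism onto \<open>\<langle>x\<^bsup>s\<^esup>\<rangle>\<close> that kills \<open>y\<close>, and similarly with
  \<open>x\<close> and \<open>y\<close> exchanged.
\<close>

section \<open>Commutator calculus\<close>

context group
begin

definition cj :: "'a \<Rightarrow> 'a \<Rightarrow> 'a"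
  where "cj z g = inv g \<otimes> z \<otimes> g"

definition cm :: "'a \<Rightarrow> 'a \<Rightarrow> 'a"
  where "cm g h = inv g \<otimes> inv h \<otimes> g \<otimes> h"

lemma inv_mult_cancel_left: "a \<in> carrier G \<Longrightarrow> b \<in> carrier G \<Longrightarrow> inv a \<otimes> (a \<otimes> b) = b"
  by (simp add: m_assoc [symmetric])

lemma mult_inv_cancel_left: "a \<in> carrier G \<Longrightarrow> b \<in> carrier G \<Longrightarrow> a \<otimes> (inv a \<otimes> b) = b"
  by (simp add: m_assoc [symmetric])

lemmas group_normalize = m_assoc inv_mult_group inv_mult_cancel_left mult_inv_cancel_left

lemma cj_closed [simp, intro]: "z \<in> carrier G \<Longrightarrow> g \<in> carrier G \<Longrightarrow> cj z g \<in> carrier G"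
  by (simp add: cj_def)

lemma cm_closed [simp, intro]: "g \<in> carrier G \<Longrightarrow> h \<in> carrier G \<Longrightarrow> cm g h \<in> carrier G"
  by (simp add: cm_def)

lemma cj_mult:
  "z \<in> carrier G \<Longrightarrow> w \<in> carrier G \<Longrightarrow> g \<in> carrier G \<Longrightarrow> cj (z \<otimes> w) g = cj z g \<otimes> cj w g"
  by (simp add: cj_def group_normalize)

lemma cj_one [simp]: "g \<in> carrier G \<Longrightarrow> cj \<one> g = \<one>"
  by (simp add: cj_def)

lemma cj_by_one [simp]: "z \<in> carrier G \<Longrightarrow> cj z \<one> = z"
  by (simp add: cj_def)

lemma cj_inv: "z \<in> carrier G \<Longrightarrow> g \<in> carrier G \<Longrightarrow> cj (inv z) g = inv (cj z g)"
  by (simp add: cj_def group_normalize)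

lemma cj_by_mult:
  "z \<in> carrier G \<Longrightarrow> g \<in> carrier G \<Longrightarrow> h \<in> carrier G \<Longrightarrow> cj z (g \<otimes> h) = cj (cj z g) h"
  by (simp add: cj_def group_normalize)

lemma cj_pow: "z \<in> carrier G \<Longrightarrow> g \<in> carrier G \<Longrightarrow> cj (z [^] (k::nat)) g = cj z g [^] k"
  by (induction k) (simp_all add: cj_mult)

lemma cj_eq_one_iff: "z \<in> carrier G \<Longrightarrow> g \<in> carrier G \<Longrightarrow> cj z g = \<one> \<longleftrightarrow> z = \<one>"
proof -
  assume zg: "z \<in> carrier G" "g \<in> carrier G"
  then have "cj (cj z g) (inv g) = z"
    by (simp add: cj_by_mult [symmetric])
  then show ?thesis
    using zg by fastforce
qed

lemma cm_eq: "g \<in> carrier G \<Longrightarrow> h \<in> carrier G \<Longrightarrow> cm g h = inv g \<otimes> cj g h"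
  by (simp add: cm_def cj_def group_normalize)

lemma cj_eq: "g \<in> carrier G \<Longrightarrow> h \<in> carrier G \<Longrightarrow> cj g h = g \<otimes> cm g h"
  by (simp add: cm_def cj_def group_normalize)

lemma cm_eq_one_iff: "g \<in> carrier G \<Longrightarrow> h \<in> carrier G \<Longrightarrow> cm g h = \<one> \<longleftrightarrow> g \<otimes> h = h \<otimes> g"
proof -
  assume gh: "g \<in> carrier G" "h \<in> carrier G"
  then have "cm g h = inv (h \<otimes> g) \<otimes> (g \<otimes> h)"
    by (simp add: cm_def group_normalize)
  then show ?thesis
    using gh inv_solve_left'[of \<one> "h \<otimes> g" "g \<otimes> h"] by auto
qed

lemma cj_eq_self_iff: "z \<in> carrier G \<Longrightarrow> h \<in> carrier G \<Longrightarrow> cj z h = z \<longleftrightarrow> cm z h = \<one>"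
  using cj_eq by auto

lemma cm_one [simp]: "g \<in> carrier G \<Longrightarrow> cm \<one> g = \<one>" "g \<in> carrier G \<Longrightarrow> cm g \<one> = \<one>"
  by (simp_all add: cm_def)

lemma inv_cm: "g \<in> carrier G \<Longrightarrow> h \<in> carrier G \<Longrightarrow> inv (cm g h) = cm h g"
  by (simp add: cm_def group_normalize)

lemma cm_mult_left:
  "g \<in> carrier G \<Longrightarrow> h \<in> carrier G \<Longrightarrow> k \<in> carrier G \<Longrightarrow> cm (g \<otimes> h) k = cj (cm g k) h \<otimes> cm h k"
  by (simp add: cm_def cj_def group_normalize)

lemma cm_mult_right:
  "g \<in> carrier G \<Longrightarrow> h \<in> carrier G \<Longrightarrow> k \<in> carrier G \<Longrightarrow> cm g (h \<otimes> k) = cm g k \<otimes> cj (cm g h) k"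
  by (simp add: cm_def cj_def group_normalize)

lemma cj_cm:
  "g \<in> carrier G \<Longrightarrow> h \<in> carrier G \<Longrightarrow> k \<in> carrier G \<Longrightarrow> cj (cm g h) k = cm (cj g k) (cj h k)"
  by (simp add: cm_def cj_def group_normalize)

lemma pow_coprime_eq_one:
  assumes "z \<in> carrier G" "z [^] (a::nat) = \<one>" "z [^] (b::nat) = \<one>" "coprime a b"
  shows "z = \<one>"
proof -
  have "ord z = 1"
    using assms by (metis coprime_common_divisor_nat pow_eq_id)
  then show ?thesis
    using assms(1) ord_eq_1 by blast
qed

lemma subgroup_pow_mem:
  assumes "subgroup H G" "z \<in> H" shows "z [^] (k::nat) \<in> H"
  using assms by (induction k) (auto simp: subgroup.one_closed subgroup.m_closed)

lemma pow_gcd_mem: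
  assumes H: "subgroup H G" and z: "z \<in> carrier G" and "z [^] (a::nat) \<in> H" "z [^] (b::nat) \<in> H"
  shows "z [^] (gcd a b) \<in> H"
proof (cases "a = 0")
  case True
  then show ?thesis using assms by simp
next
  case False
  then obtain i j where ij: "a * i = b * j + gcd a b"
    using bezout_nat by blast
  have ai: "z [^] (a * i) \<in> H" and bj: "z [^] (b * j) \<in> H"
    using assms subgroup_pow_mem[OF H] by (simp_all add: nat_pow_pow [symmetric])
  have "z [^] (a * i) = z [^] (b * j) \<otimes> z [^] gcd a b"
    using ij z by (simp add: nat_pow_mult)
  then have "z [^] gcd a b = inv (z [^] (b * j)) \<otimes> z [^] (a * i)"
    using z by (simp add: inv_mult_cancel_left)
  then show ?thesis
    using ai bj H by (simp add: subgroup.m_closed subgroup.m_inv_closed)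
qed

text \<open>Ito's computation: for \<open>b\<^bsup>a'\<^esup> = a\<^sub>2 b\<^sub>2\<close> and \<open>a\<^bsup>b'\<^esup> = b\<^sub>3 a\<^sub>3\<close> both
  \<open>[a,b]\<^bsup>a'b'\<^esup>\<close> and \<open>[a,b]\<^bsup>b'a'\<^esup>\<close> equal \<open>[a\<^sub>3,b\<^sub>2]\<close>.\<close>

lemma ito_commutators_commute:
  assumes A: "subgroup A G" and B: "subgroup B G"
    and abA: "\<And>a a'. a \<in> A \<Longrightarrow> a' \<in> A \<Longrightarrow> a \<otimes> a' = a' \<otimes> a"
    and abB: "\<And>b b'. b \<in> B \<Longrightarrow> b' \<in> B \<Longrightarrow> b \<otimes> b' = b' \<otimes> b"
    and prod: "carrier G = A <#> B"
    and mem: "a \<in> A" "a' \<in> A" "b \<in> B" "b' \<in> B"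
  shows "cj (cm a b) (a' \<otimes> b') = cj (cm a b) (b' \<otimes> a')"
proof -
  note Ac = subgroup.mem_carrier[OF A] and Bc = subgroup.mem_carrier[OF B]
  note [simp] = Ac Bc
  have fact: "\<exists>a\<in>A. \<exists>b\<in>B. g = a \<otimes> b" if "g \<in> carrier G" for g
    using that prod by (auto simp: set_mult_def)
  obtain a2 b2 where 2: "a2 \<in> A" "b2 \<in> B" "cj b a' = a2 \<otimes> b2"
    using fact[OF cj_closed[OF Bc[OF mem(3)] Ac[OF mem(2)]]] by blast
  obtain a4 b4 where 4: "a4 \<in> A" "b4 \<in> B" "inv (cj a b') = a4 \<otimes> b4"
    using fact[OF inv_closed[OF cj_closed[OF Ac[OF mem(1)] Bc[OF mem(4)]]]] by blast
  define a3 b3 where "a3 = inv a4" and "b3 = inv b4"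
  have "cj a b' = inv (a4 \<otimes> b4)"
    unfolding 4(3) [symmetric] using mem by simp
  then have 3: "a3 \<in> A" "b3 \<in> B" "cj a b' = b3 \<otimes> a3"
    unfolding a3_def b3_def using 4 A B by (simp_all add: subgroup.m_inv_closed inv_mult_group)
  have cA: "cj c d = c" if "c \<in> A" "d \<in> A" for c d
    using that abA cj_eq_self_iff cm_eq_one_iff by auto
  have cB: "cj c d = c" if "c \<in> B" "d \<in> B" for c d
    using that abB cj_eq_self_iff cm_eq_one_iff by auto
  have oA: "cm c d = \<one>" if "c \<in> A" "d \<in> A" for c d
    using that abA cm_eq_one_iff by auto
  have oB: "cm c d = \<one>" if "c \<in> B" "d \<in> B" for c d
    using that abB cm_eq_one_iff by auto
  have "cj (cm a b) a' = cm a b2"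
    using mem 2 by (simp add: cj_cm cA cm_mult_right oA)
  then have "cj (cm a b) (a' \<otimes> b') = cm (b3 \<otimes> a3) b2"
    using mem 2 3 by (simp add: cj_by_mult cj_cm cB)
  also have "\<dots> = cm a3 b2"
    using 2 3 by (simp add: cm_mult_left oB)
  finally have l: "cj (cm a b) (a' \<otimes> b') = cm a3 b2" .
  have "cj (cm a b) b' = cm a3 b"
    using mem 3 by (simp add: cj_cm cB cm_mult_left oB)
  then have "cj (cm a b) (b' \<otimes> a') = cm a3 (a2 \<otimes> b2)"
    using mem 2 3 by (simp add: cj_by_mult cj_cm cA)
  also have "\<dots> = cm a3 b2"
    using 2 3 by (simp add: cm_mult_right oA)
  finally show ?thesis using l by simp
qed

lemma generate_commute:
  assumes S: "S \<subseteq> carrier G" and com: "\<And>a b. a \<in> S \<Longrightarrow> b \<in> S \<Longrightarrow> a \<otimes> b = b \<otimes> a"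
    and "g \<in> generate G S" "h \<in> generate G S"
  shows "g \<otimes> h = h \<otimes> g"
proof -
  define C where "C T = {g \<in> carrier G. \<forall>h\<in>T. cj g h = g}" for T
  have sub: "subgroup (C T) G" if "T \<subseteq> carrier G" for T
  proof (rule subgroupI)
    have "\<one> \<in> C T" using that by (auto simp: C_def subset_iff)
    then show "C T \<noteq> {}" by blast
  qed (use that in \<open>auto simp: C_def cj_mult cj_inv subset_iff\<close>)
  have "S \<subseteq> C S"
    using S com by (auto simp: C_def subset_iff cj_eq_self_iff cm_eq_one_iff)
  then have "generate G S \<subseteq> C S"
    using generate_subgroup_incl sub S by blast
  then have "S \<subseteq> C (generate G S)"
    using S generate_incl[OF S] by (auto simp: C_def subset_iff cj_eq_self_iff cm_eq_one_iff)
  then have "generate G S \<subseteq> C (generate G S)"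
    using generate_subgroup_incl sub generate_incl[OF S] by blast
  then show ?thesis
    using assms(3,4) generate_incl[OF S] cj_eq_self_iff cm_eq_one_iff unfolding C_def by blast
qed

theorem ito_derived_abelian:
  assumes A: "subgroup A G" and B: "subgroup B G"
    and abA: "\<And>a a'. a \<in> A \<Longrightarrow> a' \<in> A \<Longrightarrow> a \<otimes> a' = a' \<otimes> a"
    and abB: "\<And>b b'. b \<in> B \<Longrightarrow> b' \<in> B \<Longrightarrow> b \<otimes> b' = b' \<otimes> b"
    and prod: "carrier G = A <#> B"
    and zw: "z \<in> derived G (carrier G)" "w \<in> derived G (carrier G)"
  shows "z \<otimes> w = w \<otimes> z"
proof -
  note Ac = subgroup.mem_carrier[OF A] and Bc = subgroup.mem_carrier[OF B]
  note [simp] = Ac Bc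
  have fact: "\<exists>a\<in>A. \<exists>b\<in>B. g = a \<otimes> b" if "g \<in> carrier G" for g
    using that prod by (auto simp: set_mult_def)
  define S where "S = {cm a b | a b. a \<in> A \<and> b \<in> B}"
  define N where "N = generate G S"
  have Sc: "S \<subseteq> carrier G" by (auto simp: S_def)
  have N: "subgroup N G" unfolding N_def by (rule generate_is_subgroup[OF Sc])
  have SN: "cm a b \<in> N" if "a \<in> A" "b \<in> B" for a b
    using that unfolding N_def S_def by (blast intro: generate.incl)
  have cjB: "cj (cm a b) b' \<in> N" if "a \<in> A" "b \<in> B" "b' \<in> B" for a b b'
  proof -
    have "cj (cm a b) b' = inv (cm a b') \<otimes> cm a (b \<otimes> b')"
      using that by (simp add: cm_mult_right inv_mult_cancel_left)
    then show ?thesis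
      using that SN N B by (simp add: subgroup.m_closed subgroup.m_inv_closed)
  qed
  have oA: "cm c d = \<one>" if "c \<in> A" "d \<in> A" for c d
    using that abA cm_eq_one_iff by auto
  have oB: "cm c d = \<one>" if "c \<in> B" "d \<in> B" for c d
    using that abB cm_eq_one_iff by auto
  have all: "cm g h \<in> N" if gh: "g \<in> carrier G" "h \<in> carrier G" for g h
  proof -
    obtain a b c d where f: "a \<in> A" "b \<in> B" "c \<in> A" "d \<in> B" "g = a \<otimes> b" "h = c \<otimes> d"
      using fact gh by metis
    have "cm (a \<otimes> b) (c \<otimes> d) = cj (cm a d) b \<otimes> cj (inv (cm c b)) d"
      using f by (simp add: cm_mult_left cm_mult_right oA oB inv_cm)
    then show ?thesis
      using f cjB N by (simp add: cj_inv subgroup.m_closed subgroup.m_inv_closed)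
  qed
  have "derived_set G (carrier G) \<subseteq> N"
  proof
    fix c assume "c \<in> derived_set G (carrier G)"
    then obtain g h where "g \<in> carrier G" "h \<in> carrier G" "c = g \<otimes> h \<otimes> inv g \<otimes> inv h"
      by auto
    then show "c \<in> N"
      using all[of "inv g" "inv h"] by (simp add: cm_def)
  qed
  then have DN: "derived G (carrier G) \<subseteq> N"
    unfolding derived_def by (rule generate_subgroup_incl[OF _ N])
  have com: "s \<otimes> s' = s' \<otimes> s" if ss: "s \<in> S" "s' \<in> S" for s s'
  proof -
    obtain a b a' b' where f: "a \<in> A" "b \<in> B" "a' \<in> A" "b' \<in> B" "s = cm a b" "s' = cm a' b'"
      using ss unfolding S_def by blast
    define w where "w = inv b' \<otimes> inv a'"
    have w: "w \<in> carrier G" and s: "s \<in> carrier G"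
      using f by (simp_all add: w_def)
    have "cj s (inv a' \<otimes> inv b') = cj s w"
      using ito_commutators_commute[OF A B abA abB prod, of a "inv a'" b "inv b'"] f A B
      by (simp add: w_def subgroup.m_inv_closed)
    then have "cj s (inv a' \<otimes> inv b' \<otimes> inv w) = cj s (w \<otimes> inv w)"
      using f s w by (subst (1 2) cj_by_mult) auto
    moreover have "inv a' \<otimes> inv b' \<otimes> inv w = s'"
      using f by (simp add: cm_def w_def group_normalize)
    ultimately show ?thesis
      using f s w by (simp add: cj_eq_self_iff cm_eq_one_iff)
  qed
  show ?thesis
    using generate_commute[OF Sc com] zw DN unfolding N_def by blast
qed

end

section \<open>Isobicyclic groups\<close>

locale isob = group G for G (structure) +
  fixes n :: nat and x y :: 'a
  assumes isobicyclic: "isobicyclic n G x y" and n_pos: "n \<ge> 1"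
begin

abbreviation XS where "XS \<equiv> generate G {x}"
abbreviation YS where "YS \<equiv> generate G {y}"
abbreviation N where "N \<equiv> derived G (carrier G)"

lemma x_closed [simp, intro]: "x \<in> carrier G" and y_closed [simp, intro]: "y \<in> carrier G"
  and ord_x [simp]: "ord x = n" and ord_y [simp]: "ord y = n"
  and carrier_eq: "carrier G = XS <#> YS" and X_Int_Y: "XS \<inter> YS = {\<one>}"
  using isobicyclic by (auto simp: isobicyclic_def)

lemma mem_X_iff: "g \<in> XS \<longleftrightarrow> (\<exists>i::nat. g = x [^] i)"
  using generate_pow_nat[of x] n_pos by auto

lemma mem_Y_iff: "g \<in> YS \<longleftrightarrow> (\<exists>i::nat. g = y [^] i)"
  using generate_pow_nat[of y] n_pos by auto

lemma X_pow [simp, intro]: "x [^] (i::nat) \<in> XS"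
  using mem_X_iff by blast

lemma Y_pow [simp, intro]: "y [^] (i::nat) \<in> YS"
  using mem_Y_iff by blast

lemma subgroup_X: "subgroup XS G" and subgroup_Y: "subgroup YS G"
  by (simp_all add: generate_is_subgroup)

lemmas X_carrier [simp] = subgroup.mem_carrier[OF subgroup_X]
lemmas Y_carrier [simp] = subgroup.mem_carrier[OF subgroup_Y]

lemma X_comm: "g \<in> XS \<Longrightarrow> h \<in> XS \<Longrightarrow> g \<otimes> h = h \<otimes> g"
  using generate_commute[of "{x}" g h] by auto

lemma Y_comm: "g \<in> YS \<Longrightarrow> h \<in> YS \<Longrightarrow> g \<otimes> h = h \<otimes> g"
  using generate_commute[of "{y}" g h] by auto

lemma cm_X [simp]: "g \<in> XS \<Longrightarrow> h \<in> XS \<Longrightarrow> cm g h = \<one>"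
  by (simp add: cm_eq_one_iff X_comm)

lemma cm_Y [simp]: "g \<in> YS \<Longrightarrow> h \<in> YS \<Longrightarrow> cm g h = \<one>"
  by (simp add: cm_eq_one_iff Y_comm)

lemma eq_one_if_mem_X_Y: "g \<in> XS \<Longrightarrow> g \<in> YS \<Longrightarrow> g = \<one>"
  using X_Int_Y by blast

lemma X_Y_factor: "g \<in> carrier G \<Longrightarrow> \<exists>a\<in>XS. \<exists>b\<in>YS. g = a \<otimes> b"
  using carrier_eq by (auto simp: set_mult_def)

lemma xy_factor: "g \<in> carrier G \<Longrightarrow> \<exists>(i::nat) (j::nat). g = x [^] i \<otimes> y [^] j"
  using X_Y_factor[of g] unfolding Bex_def mem_X_iff mem_Y_iff by blast

lemma X_inv_Y_factor:
  assumes "g \<in> carrier G" obtains a b where "a \<in> XS" "b \<in> YS" "b = a \<otimes> g"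
proof -
  obtain a b where ab: "a \<in> XS" "b \<in> YS" "g = a \<otimes> b"
    using X_Y_factor assms by blast
  then have "b = inv a \<otimes> g"
    by (simp add: inv_mult_cancel_left)
  then show ?thesis
    using that ab subgroup.m_inv_closed[OF subgroup_X] by blast
qed

lemma X_Y_unique:
  assumes "a \<in> XS" "a' \<in> XS" "b \<in> YS" "b' \<in> YS" "a \<otimes> b = a' \<otimes> b'"
  shows "a = a' \<and> b = b'"
proof -
  have "inv a' \<otimes> a = b' \<otimes> inv b"
  proof -
    have "inv a' \<otimes> (a \<otimes> b) = b'"
      using assms by (simp add: inv_mult_cancel_left)
    then have "inv a' \<otimes> (a \<otimes> b) \<otimes> inv b = b' \<otimes> inv b"
      by simp
    then show ?thesis
      using assms(1-4) by (simp add: m_assoc)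
  qed
  then have "inv a' \<otimes> a \<in> XS \<inter> YS"
    using assms(1-4) subgroup.m_closed[OF subgroup_X] subgroup.m_inv_closed[OF subgroup_X]
      subgroup.m_closed[OF subgroup_Y] subgroup.m_inv_closed[OF subgroup_Y] by (metis IntI)
  then have "inv a' \<otimes> a = \<one>"
    using X_Int_Y by blast
  then have "a = a'"
    using assms(1,2) inv_solve_left'[of \<one> a' a] by simp
  then show ?thesis
    using assms by simp
qed

lemma x_pow_eq_one_iff: "x [^] (i::nat) = \<one> \<longleftrightarrow> n dvd i"
  and y_pow_eq_one_iff: "y [^] (i::nat) = \<one> \<longleftrightarrow> n dvd i"
  by (simp_all add: pow_eq_id)

definition xy_multiples :: "nat \<Rightarrow> 'a set"
  where "xy_multiples r = {x [^] i \<otimes> y [^] j | i j :: nat. r dvd i \<and> r dvd j}"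

lemma mem_xy_multiples_iff:
  assumes "r dvd n"
  shows "x [^] (i::nat) \<otimes> y [^] (j::nat) \<in> xy_multiples r \<longleftrightarrow> r dvd i \<and> r dvd j"
proof
  assume "x [^] i \<otimes> y [^] j \<in> xy_multiples r"
  then obtain k l :: nat where kl: "r dvd k" "r dvd l" "x [^] i \<otimes> y [^] j = x [^] k \<otimes> y [^] l"
    unfolding xy_multiples_def by blast
  then have "x [^] i = x [^] k" "y [^] j = y [^] l"
    using X_Y_unique X_pow Y_pow by blast+
  then have "int n dvd int i - int k" "int n dvd int j - int l"
    using int_pow_eq[of x "int i" "int k"] int_pow_eq[of y "int j" "int l"]
    by (simp_all add: int_pow_int dvd_diff_commute)
  then have "int r dvd int i - int k" "int r dvd int j - int l"
    using assms by (meson dvd_trans int_dvd_int_iff)+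
  then show "r dvd i \<and> r dvd j"
    using kl dvd_add[of "int r" "int i - int k" "int k"] dvd_add[of "int r" "int j - int l" "int l"]
    by simp
qed (auto simp: xy_multiples_def)

lemma card_X: "card XS = n" and card_Y: "card YS = n"
  using generate_pow_card[of x] generate_pow_card[of y] by simp_all

lemma bij_X_Y: "bij_betw (\<lambda>(a, b). a \<otimes> b) (XS \<times> YS) (carrier G)"
  unfolding bij_betw_def inj_on_def using X_Y_unique X_Y_factor by (auto simp: image_iff)

lemma order_eq: "order G = n\<^sup>2"
  unfolding order_def using bij_betw_same_card[OF bij_X_Y]
  by (simp add: card_cartesian_product card_X card_Y power2_eq_square)

lemma finite_G [simp, intro]: "finite (carrier G)"
proof (rule ccontr)
  assume "infinite (carrier G)"
  then show False
    using order_eq n_pos by (simp add: order_def)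
qed

lemma pow_X [simp]: "g \<in> XS \<Longrightarrow> g [^] n = \<one>"
  by (auto simp: mem_X_iff nat_pow_pow x_pow_eq_one_iff)

lemma pow_Y [simp]: "g \<in> YS \<Longrightarrow> g [^] n = \<one>"
  by (auto simp: mem_Y_iff nat_pow_pow y_pow_eq_one_iff)

lemma swap_auto: "\<exists>\<phi>. \<phi> \<in> iso G G \<and> \<phi> x = y \<and> \<phi> y = x"
  using isobicyclic by (auto simp: isobicyclic_def)

lemma carrier_eq_swap: "carrier G = YS <#> XS"
proof -
  have "\<exists>b\<in>YS. \<exists>a\<in>XS. g = b \<otimes> a" if g: "g \<in> carrier G" for g
  proof -
    obtain a b where ab: "a \<in> XS" "b \<in> YS" "inv g = a \<otimes> b"
      using X_Y_factor[OF inv_closed[OF g]] by blast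
    then have "g = inv b \<otimes> inv a"
      using inv_mult_group[of a b] inv_inv[OF g] by simp
    then show ?thesis
      using ab subgroup.m_inv_closed[OF subgroup_X] subgroup.m_inv_closed[OF subgroup_Y] by blast
  qed
  then show ?thesis
    by (auto simp: set_mult_def)
qed

lemma swapped: "isob G n y x"
proof unfold_locales
  show "isobicyclic n G y x"
    unfolding isobicyclic_def
    using swap_auto carrier_eq_swap X_Int_Y group_axioms ord_x ord_y x_closed y_closed by blast
qed (rule n_pos)

lemma subgroup_N: "subgroup N G"
  by (simp add: derived_is_subgroup)

lemmas N_carrier [simp] = subgroup.mem_carrier[OF subgroup_N]
lemmas N_mult [simp] = subgroup.m_closed[OF subgroup_N]
lemmas N_inv [simp] = subgroup.m_inv_closed[OF subgroup_N]
lemmas N_one [simp] = subgroup.one_closed[OF subgroup_N]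
lemmas N_pow [simp] = subgroup_pow_mem[OF subgroup_N]

lemma N_comm: "z \<in> N \<Longrightarrow> w \<in> N \<Longrightarrow> z \<otimes> w = w \<otimes> z"
  using ito_derived_abelian[OF subgroup_X subgroup_Y X_comm Y_comm carrier_eq] .

lemma cm_mem_N [simp]: assumes "g \<in> carrier G" "h \<in> carrier G" shows "cm g h \<in> N"
proof -
  have "cm g h = inv g \<otimes> inv h \<otimes> inv (inv g) \<otimes> inv (inv h)"
    unfolding cm_def using assms by (simp only: inv_inv)
  then have "cm g h \<in> derived_set G (carrier G)"
    using inv_closed[OF assms(1)] inv_closed[OF assms(2)] by blast
  then show ?thesis
    unfolding derived_def by (rule generate.incl)
qed

lemma cj_mem_N [simp]: "z \<in> N \<Longrightarrow> g \<in> carrier G \<Longrightarrow> cj z g \<in> N"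
  by (simp add: cj_eq)

lemma cj_N [simp]: "z \<in> N \<Longrightarrow> w \<in> N \<Longrightarrow> cj z w = z"
  by (simp add: cj_eq_self_iff cm_eq_one_iff N_comm)

lemma cj_N_commute:
  assumes "z \<in> N" "g \<in> carrier G" "h \<in> carrier G" shows "cj (cj z g) h = cj (cj z h) g"
proof -
  have "g \<otimes> h = h \<otimes> g \<otimes> cm g h"
    using assms by (simp add: cm_def group_normalize)
  then have "cj z (g \<otimes> h) = cj z (h \<otimes> g)"
    using assms by (simp add: cj_by_mult)
  then show ?thesis
    using assms by (simp add: cj_by_mult)
qed

lemma N_pow_mult: "z \<in> N \<Longrightarrow> w \<in> N \<Longrightarrow> (z \<otimes> w) [^] (k::nat) = z [^] k \<otimes> w [^] k"
  by (simp add: pow_mult_distrib N_comm)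

lemma cm_N_mult: "z \<in> N \<Longrightarrow> w \<in> N \<Longrightarrow> g \<in> carrier G \<Longrightarrow> cm (z \<otimes> w) g = cm z g \<otimes> cm w g"
  by (simp add: cm_mult_left)

lemma cm_N_pow: "z \<in> N \<Longrightarrow> g \<in> carrier G \<Longrightarrow> cm (z [^] (k::nat)) g = cm z g [^] k"
  by (induction k) (simp_all add: cm_N_mult)

lemma cm_N_inv: assumes "z \<in> N" "g \<in> carrier G" shows "cm (inv z) g = inv (cm z g)"
proof -
  have "cm (inv z) g \<otimes> cm z g = \<one>"
    using assms by (simp add: cm_N_mult [symmetric])
  then show ?thesis
    using assms by (simp add: inv_equality)
qed

lemma cm_cj: "z \<in> N \<Longrightarrow> g \<in> carrier G \<Longrightarrow> h \<in> carrier G \<Longrightarrow> cm (cj z h) g = cj (cm z g) h"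
  using cj_N_commute[of z h g] by (simp add: cm_eq cj_mult cj_inv)

lemma cm_cm_commute:
  assumes "z \<in> N" "g \<in> carrier G" "h \<in> carrier G" shows "cm (cm z g) h = cm (cm z h) g"
proof -
  have "cm (cm z h) g = cm (inv z \<otimes> cj z h) g"
    using assms by (simp add: cm_eq)
  also have "\<dots> = inv (cm z g) \<otimes> cj (cm z g) h"
    using assms by (simp add: cm_N_mult cm_N_inv cm_cj)
  finally show ?thesis
    using assms by (simp add: cm_eq)
qed

text \<open>The Hall--Witt identity in a group with abelian derived subgroup, when \<open>g\<close> and \<open>u\<close>
  commute.\<close>

lemma hall_witt:
  assumes "g \<in> carrier G" "u \<in> carrier G" "v \<in> carrier G" "cm g u = \<one>"
  shows "cm (cm g v) u = inv (cm (cm v u) g)"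
proof -
  have "cj (cm g v) u = cm (cj g u) (cj v u)"
    using assms by (simp add: cj_cm)
  also have "\<dots> = cm g (v \<otimes> cm v u)"
    using assms by (simp add: cj_eq)
  also have "\<dots> = cm g (cm v u) \<otimes> cm g v"
    using assms by (simp add: cm_mult_right)
  also have "\<dots> = cm g v \<otimes> cm g (cm v u)"
    using assms by (simp add: N_comm)
  finally have "cm (cm g v) u = cm g (cm v u)"
    using assms by (simp only: cm_eq[of "cm g v"] cm_closed inv_mult_cancel_left)
  then show ?thesis
    using assms by (simp add: inv_cm)
qed

lemma pow_order_N: "z \<in> carrier G \<Longrightarrow> z [^] (n\<^sup>2) = \<one>"
  using pow_order_eq_1 order_eq by metis

lemma cm_cm_eq_one:
  assumes z: "z \<in> N" "z [^] (l::nat) = \<one>" and w: "w \<in> carrier G" "w [^] (k::nat) = \<one>"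
    and kl: "coprime k l" and c: "cm (cm z w) w = \<one>"
  shows "cm z w = \<one>"
proof -
  define c where "c = cm z w"
  have cN: "c \<in> N" and cw: "cj c w = c"
    using z w c by (simp_all add: c_def cj_eq_self_iff)
  have zw: "cj z w = z \<otimes> c"
    using z w by (simp add: c_def cj_eq)
  have "cj z (w [^] i) = z \<otimes> c [^] i" for i :: nat
  proof (induction i)
    case (Suc i)
    have "cj z (w [^] Suc i) = cj (z \<otimes> c [^] i) w"
      using Suc z w by (simp add: cj_by_mult)
    also have "\<dots> = z \<otimes> c \<otimes> c [^] i"
      using z w cN zw cw by (simp add: cj_mult cj_pow)
    also have "\<dots> = z \<otimes> c [^] Suc i"
      using z cN nat_pow_Suc2[of c i] by (simp add: m_assoc)
    finally show ?case .
  qed (use z in simp)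
  from this[of k] have "z \<otimes> c [^] k = z \<otimes> \<one>"
    using w z by simp
  then have "c [^] k = \<one>"
    using z cN by (simp del: r_one)
  moreover have "c [^] l = \<one>"
    using z w by (simp add: c_def cm_N_pow [symmetric])
  ultimately show ?thesis
    using pow_coprime_eq_one[of c k l] cN kl by (simp add: c_def)
qed

end

section \<open>The primary components of the derived subgroup\<close>

locale isob_prime = isob +
  fixes p a m' :: nat
  assumes prime_p: "Factorial_Ring.prime p" and n_eq: "n = p ^ a * m'" and p_not_dvd: "\<not> p dvd m'"
begin

abbreviation m :: nat where "m \<equiv> p ^ a"
abbreviation u where "u \<equiv> x [^] m"
abbreviation v where "v \<equiv> y [^] m"

definition M where "M = {z \<in> N. z [^] (m\<^sup>2) = \<one>}"

lemma prime_swapped: "isob_prime G n y x p a m'"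
proof -
  interpret sw: isob G n y x by (rule swapped)
  show ?thesis
    by unfold_locales (rule prime_p n_eq p_not_dvd)+
qed

lemma coprime_m: "coprime m' m"
  using prime_imp_coprime[OF prime_p p_not_dvd] by (simp add: coprime_commute)

lemma u_pow: "u [^] m' = \<one>" and v_pow: "v [^] m' = \<one>"
  by (simp_all add: nat_pow_pow x_pow_eq_one_iff y_pow_eq_one_iff n_eq)

lemma M_N: "z \<in> M \<Longrightarrow> z \<in> N"
  by (simp add: M_def)

lemma finite_M [simp, intro]: "finite M"
  by (rule finite_subset[OF _ finite_G]) (auto simp: M_def)

lemma M_mult [simp]: "z \<in> M \<Longrightarrow> w \<in> M \<Longrightarrow> z \<otimes> w \<in> M"
  by (simp add: M_def N_pow_mult)

lemma M_one [simp]: "\<one> \<in> M"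
  by (simp add: M_def)

lemma M_inv [simp]: "z \<in> M \<Longrightarrow> inv z \<in> M"
  by (simp add: M_def nat_pow_inv)

lemma M_pow [simp]: "z \<in> M \<Longrightarrow> z [^] (k::nat) \<in> M"
  by (induction k) auto

lemma M_cj [simp]: "z \<in> M \<Longrightarrow> g \<in> carrier G \<Longrightarrow> cj z g \<in> M"
  by (simp add: M_def cj_pow [symmetric])

lemma N_pow_M [simp]: "z \<in> N \<Longrightarrow> z [^] (m'\<^sup>2) \<in> M"
  using pow_order_N[of z] by (simp add: M_def nat_pow_pow n_eq power_mult_distrib mult.commute)

lemma M_pow_eq_one: "z \<in> M \<Longrightarrow> z [^] m' = \<one> \<Longrightarrow> z = \<one>"
  using pow_coprime_eq_one[of z m' "m\<^sup>2"] coprime_m by (simp add: M_def)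

lemma M_pow_sq_eq_one: "z \<in> M \<Longrightarrow> z [^] (m'\<^sup>2) = \<one> \<Longrightarrow> z = \<one>"
  using pow_coprime_eq_one[of z "m'\<^sup>2" "m\<^sup>2"] coprime_m by (simp add: M_def)

declare M_N [simp]

lemma M_cm [simp]: "z \<in> M \<Longrightarrow> g \<in> carrier G \<Longrightarrow> cm z g \<in> M"
  by (simp add: cm_eq)

lemma M_ord: "z \<in> M \<Longrightarrow> z [^] (m\<^sup>2) = \<one>"
  unfolding M_def by blast

lemma coprime_m_sq: "coprime m' (m\<^sup>2)"
  using coprime_m by simp

lemma cm_cm_u_eq_one: "z \<in> M \<Longrightarrow> cm (cm z u) u = \<one> \<Longrightarrow> cm z u = \<one>"
  by (rule cm_cm_eq_one[OF M_N M_ord _ u_pow]) (auto simp: coprime_m_sq simp del: coprime_power_right_iff)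

lemma cm_cm_v_eq_one: "z \<in> M \<Longrightarrow> cm (cm z v) v = \<one> \<Longrightarrow> cm z v = \<one>"
  by (rule cm_cm_eq_one[OF M_N M_ord _ v_pow]) (auto simp: coprime_m_sq simp del: coprime_power_right_iff)

text \<open>Every \<open>c \<in> M\<close> is \<open>g\<inverse>h\<close> with \<open>g \<in> \<langle>x\<rangle>\<close> and \<open>h \<in> \<langle>y\<rangle>\<close>, and the Hall--Witt identity
  turns \<open>\<Delta> c = [c,v,u]\<close> into \<open>[[v,u],g]\<close>. As \<open>\<Delta>\<close> is bijective on its image, \<open>k = \<Delta>[v,u]\<close>
  (up to a power) satisfies \<open>k\<inverse> = [k,g]\<close> for some \<open>g\<close>, so \<open>k = 1\<close>.\<close>

lemma cm_cm_u_v: assumes z: "z \<in> M" shows "cm (cm z u) v = \<one>"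
proof -
  define D where "D z = cm (cm z u) v" for z
  define C where "C = D ` M"
  have DM: "D z \<in> M" if "z \<in> M" for z
    using that by (simp add: D_def)
  have Dmult: "D (z \<otimes> w) = D z \<otimes> D w" if "z \<in> N" "w \<in> N" for z w
    using that by (simp add: D_def cm_N_mult)
  have Dinv: "D (inv z) = inv (D z)" if "z \<in> N" for z
    using that by (simp add: D_def cm_N_inv)
  have Dpow: "D (z [^] (k::nat)) = D z [^] k" if "z \<in> N" for z k
    using that by (simp add: D_def cm_N_pow)
  have DD: "D z = \<one>" if zM: "z \<in> M" and DDz: "D (D z) = \<one>" for z
  proof -
    have "cm (cm (cm (cm z v) v) u) u = \<one>"
      using DDz zM by (simp add: D_def cm_cm_commute[of _ u v])
    then have "cm (cm (cm z v) v) u = \<one>"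
      using zM cm_cm_u_eq_one[of "cm (cm z v) v"] by simp
    then have "cm (cm (cm z u) v) v = \<one>"
      using zM by (simp add: cm_cm_commute[of _ u v])
    then show ?thesis
      using zM cm_cm_v_eq_one[of "cm z u"] by (simp add: D_def)
  qed
  have Cc: "w \<in> M" if "w \<in> C" for w
    using that DM by (auto simp: C_def)
  define E where "E w = D w [^] (m'\<^sup>2)" for w
  have "inj_on E C"
  proof (rule inj_onI)
    fix w w' assume ww: "w \<in> C" "w' \<in> C" and e: "E w = E w'"
    define d where "d = w \<otimes> inv w'"
    obtain z z' where zz: "z \<in> M" "z' \<in> M" "w = D z" "w' = D z'"
      using ww by (auto simp: C_def)
    have d: "d = D (z \<otimes> inv z')"
      using zz by (simp add: d_def Dmult Dinv)
    have "D d [^] (m'\<^sup>2) = E w \<otimes> inv (E w')"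
      using ww Cc DM by (simp add: d_def E_def Dmult Dinv N_pow_mult nat_pow_inv)
    then have "D d [^] (m'\<^sup>2) = \<one>"
      using e ww Cc DM by (simp add: E_def)
    then have "D d = \<one>"
      using M_pow_sq_eq_one[of "D d"] DM ww Cc by (simp add: d_def)
    then have "d = \<one>"
      using DD[of "z \<otimes> inv z'"] zz d by simp
    then show "w = w'"
      using ww Cc inv_solve_right'[of \<one> w w'] by (simp add: d_def)
  qed
  moreover have "E ` C \<subseteq> C"
  proof clarify
    fix w assume "w \<in> C"
    then have "E w = D (w [^] (m'\<^sup>2))" "w [^] (m'\<^sup>2) \<in> M"
      using Cc by (simp_all add: E_def Dpow)
    then show "E w \<in> C"
      by (simp add: C_def)
  qed
  ultimately have surj: "E ` C = C"
    by (intro endo_inj_surj) (auto simp: C_def)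
  define w0 where "w0 = cm v u"
  have w0: "w0 \<in> N" by (simp add: w0_def)
  define k where "k = D (w0 [^] (m'\<^sup>2))"
  have kC: "k \<in> C" and kM: "k \<in> M"
    using w0 DM by (simp_all add: k_def C_def)
  have key: "\<exists>g\<in>XS. E (D c) = cm k g" if c: "c \<in> M" for c
  proof -
    have cc: "c \<in> carrier G" using c by simp
    obtain g h where gh: "g \<in> XS" "h \<in> YS" "h = g \<otimes> c"
      using X_inv_Y_factor[OF cc] by blast
    have "cm (g \<otimes> c) v = \<one>"
      using gh by (metis Y_pow cm_Y)
    then have "cm g v \<otimes> cm c v = \<one>"
      using gh c by (simp add: cm_mult_left)
    then have gv: "cm g v = inv (cm c v)"
      using gh c by (simp add: inv_equality [symmetric])
    have "cm (cm g v) u = inv (cm w0 g)"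
      using hall_witt[of g u v] gh by (simp add: w0_def)
    then have "inv (cm (cm c v) u) = inv (cm w0 g)"
      using gv c by (simp add: cm_N_inv)
    then have "cm (cm c v) u = cm w0 g"
      using c w0 gh by (metis M_N N_carrier X_carrier X_pow Y_carrier Y_pow cm_closed inv_inv)
    then have Dc: "D c = cm w0 g"
      using c by (simp add: D_def cm_cm_commute[of _ u v])
    have "E (D c) = D (cm w0 g) [^] (m'\<^sup>2)"
      by (simp add: E_def Dc)
    also have "\<dots> = cm (D w0) g [^] (m'\<^sup>2)"
      using w0 gh by (simp add: D_def cm_cm_commute[of _ g])
    also have "\<dots> = cm k g"
      using w0 gh by (simp add: k_def D_def cm_N_pow)
    finally show ?thesis using gh by blast
  qed
  have "inv k \<in> C"
    using w0 by (auto simp: C_def k_def Dinv [symmetric])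
  then obtain c where "c \<in> M" "inv k = E (D c)"
    using surj unfolding C_def by blast
  then obtain g where g: "g \<in> XS" "inv k = cm k g"
    using key by metis
  then have "inv k \<otimes> cj k g = inv k \<otimes> \<one>"
    using kM by (simp add: cm_eq)
  then have "cj k g = \<one>"
    using kM g by (simp del: r_one)
  then have k: "k = \<one>"
    using kM g by (simp add: cj_eq_one_iff)
  obtain g where "g \<in> XS" "E (D z) = cm k g"
    using key[OF z] by blast
  then have "D (D z) [^] (m'\<^sup>2) = \<one>"
    by (simp add: E_def k)
  then have "D (D z) = \<one>"
    using M_pow_sq_eq_one[of "D (D z)"] DM z by simp
  then show ?thesis
    using DD[OF z] by (simp add: D_def)
qed

end

context isob_prime
begin

lemma swap_moves_M:
  assumes "\<exists>z\<in>M. cm z u \<noteq> \<one>" shows "\<exists>z\<in>M. cm z v \<noteq> \<one>"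
proof -
  obtain z where z: "z \<in> M" "cm z u \<noteq> \<one>"
    using assms by blast
  obtain \<phi> where \<phi>: "\<phi> \<in> iso G G" "\<phi> x = y" "\<phi> y = x"
    using swap_auto by blast
  interpret \<phi>: group_hom G G \<phi>
    using \<phi>(1) by unfold_locales (simp add: iso_def)
  have hom_cm: "\<phi> (cm g h) = cm (\<phi> g) (\<phi> h)" if "g \<in> carrier G" "h \<in> carrier G" for g h
    using that by (simp add: cm_def)
  have "\<phi> ` N \<subseteq> N"
    using \<phi>.derived_img[of "carrier G"] mono_derived[OF \<phi>.img_is_subgroup[THEN subgroup.subset]]
    by (simp add: iso_def)
  then have \<phi>z: "\<phi> z \<in> M"
    using z(1) \<phi>.hom_nat_pow[of z "m\<^sup>2", symmetric] unfolding M_def by auto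
  have "\<phi> (cm z u) \<noteq> \<one>"
  proof
    assume "\<phi> (cm z u) = \<one>"
    then have "cm z u = \<one>"
      using \<phi>(1) z(1) \<phi>.hom_one unfolding iso_def bij_betw_def
      by (metis (no_types, lifting) M_N N_carrier X_carrier X_pow cm_closed inj_onD mem_Collect_eq one_closed)
    then show False using z by simp
  qed
  moreover have "\<phi> (cm z u) = cm (\<phi> z) v"
    using z(1) \<phi> by (simp add: hom_cm \<phi>.hom_nat_pow)
  ultimately show ?thesis using \<phi>z by auto
qed

lemma X_p_elements_meet:
  assumes g: "g \<in> XS" "g \<noteq> \<one>" "g [^] m = \<one>" and h: "h \<in> XS" "h \<noteq> \<one>" "h [^] m = \<one>"
  shows "\<exists>(i::nat) (j::nat). g [^] i = h [^] j \<and> g [^] i \<noteq> \<one>"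
proof -
  obtain k l :: nat where kl: "g = x [^] k" "h = x [^] l"
    using g h mem_X_iff by auto
  have "n dvd k * m" "n dvd l * m" "\<not> n dvd k" "\<not> n dvd l"
    using g h by (simp_all add: kl nat_pow_pow x_pow_eq_one_iff)
  moreover have n0: "m > 0"
    using prime_p by (simp add: prime_gt_0_nat)
  ultimately have d: "m' dvd k" "m' dvd l" "\<not> m dvd k" "\<not> m dvd l" and nz: "k \<noteq> 0" "l \<noteq> 0"
    using coprime_m by (auto simp: n_eq mult.commute divides_mult coprime_commute intro: divides_mult)
  have "\<not> m dvd lcm k l"
  proof
    assume "m dvd lcm k l"
    then have "a \<le> max (multiplicity p k) (multiplicity p l)"
      using multiplicity_geI[of "lcm k l" p a] multiplicity_lcm[of k l p] nz prime_p prime_gt_1_nat[OF prime_p]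
      by simp
    then show False
      using d(3,4) multiplicity_dvd'[of a p k] multiplicity_dvd'[of a p l] by (auto simp: max_def split: if_splits)
  qed
  then have "\<not> n dvd lcm k l"
    by (metis dvd_mult_left n_eq)
  moreover have "g [^] (lcm k l div k) = x [^] lcm k l" "h [^] (lcm k l div l) = x [^] lcm k l"
    by (simp_all add: kl nat_pow_pow)
  ultimately show ?thesis
    by (metis x_pow_eq_one_iff)
qed

lemma Y_p_elements_meet:
  assumes "g \<in> YS" "g \<noteq> \<one>" "g [^] m = \<one>" "h \<in> YS" "h \<noteq> \<one>" "h [^] m = \<one>"
  shows "\<exists>(i::nat) (j::nat). g [^] i = h [^] j \<and> g [^] i \<noteq> \<one>"
proof -
  interpret sw: isob_prime G n y x p a m' by (rule prime_swapped)
  show ?thesis using sw.X_p_elements_meet assms .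
qed

definition A where "A = (\<lambda>z. cm z u) ` M"

lemma A_I [simp]: "z \<in> M \<Longrightarrow> cm z u \<in> A"
  by (simp add: A_def)

lemma A_E: assumes "c \<in> A" obtains z where "z \<in> M" "c = cm z u"
  using assms by (auto simp: A_def)

lemma A_M [simp]: "c \<in> A \<Longrightarrow> c \<in> M"
  by (erule A_E) simp

lemma A_cm_v [simp]: "c \<in> A \<Longrightarrow> cm c v = \<one>"
  by (erule A_E) (simp add: cm_cm_u_v)

lemma A_cm_u_eq_one: "c \<in> A \<Longrightarrow> cm c u = \<one> \<Longrightarrow> c = \<one>"
  by (metis A_E cm_cm_u_eq_one)

lemma A_mult [simp]: assumes "c \<in> A" "d \<in> A" shows "c \<otimes> d \<in> A"
proof -
  obtain z w where "z \<in> M" "w \<in> M" "c = cm z u" "d = cm w u"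
    using assms by (meson A_E)
  then have "c \<otimes> d = cm (z \<otimes> w) u"
    by (simp add: cm_N_mult)
  then show ?thesis
    using \<open>z \<in> M\<close> \<open>w \<in> M\<close> by simp
qed

lemma A_one [simp]: "\<one> \<in> A"
  using A_I[of \<one>] by simp

lemma A_pow [simp]: "c \<in> A \<Longrightarrow> c [^] (k::nat) \<in> A"
  by (induction k) auto

lemma A_cj [simp]: "c \<in> A \<Longrightarrow> g \<in> carrier G \<Longrightarrow> cj c g \<in> A"
  by (erule A_E) (simp add: cm_cj [symmetric])

lemma A_coset_pow:
  assumes "c \<in> A" "g \<in> carrier G"
  shows "\<exists>d\<in>A. (g \<otimes> c) [^] (k::nat) = g [^] k \<otimes> d"
proof (induction k)
  case 0
  show ?case by (rule bexI[of _ \<one>]) auto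
next
  case (Suc k)
  then obtain d where d: "d \<in> A" "(g \<otimes> c) [^] k = g [^] k \<otimes> d" by blast
  have "(g \<otimes> c) [^] Suc k = g [^] k \<otimes> (d \<otimes> g) \<otimes> c"
    using d assms by (simp add: m_assoc)
  also have "d \<otimes> g = g \<otimes> cj d g"
    using d assms by (simp add: cj_def group_normalize)
  also have "g [^] k \<otimes> (g \<otimes> cj d g) \<otimes> c = g [^] Suc k \<otimes> (cj d g \<otimes> c)"
    using d assms by (simp add: m_assoc)
  finally show ?case
    using d assms by (intro bexI[of _ "cj d g \<otimes> c"]) auto
qed

lemma A_X: "c \<in> A \<Longrightarrow> c \<in> XS \<Longrightarrow> c = \<one>"
  by (rule A_cm_u_eq_one) auto

lemma A_factor:
  assumes c: "c \<in> A" and g: "g \<in> XS" and h: "g \<otimes> c \<in> YS"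
  shows "cm g v = \<one>" "(g \<otimes> c) [^] m = \<one>" "g [^] m = \<one>"
proof -
  have "cm (g \<otimes> c) v = \<one>"
    using h by simp
  then show "cm g v = \<one>"
    using c g by (simp add: cm_mult_left)
  define h0 where "h0 = (g \<otimes> c) [^] m"
  obtain d where d: "d \<in> A" "h0 = g [^] m \<otimes> d"
    using A_coset_pow[OF c X_carrier[OF g], of m] unfolding h0_def by blast
  have gm: "g [^] m \<in> XS"
    using g subgroup_pow_mem[OF subgroup_X] by blast
  have h0Y: "h0 \<in> YS"
    unfolding h0_def using h subgroup_pow_mem[OF subgroup_Y] by blast
  have e: "cm h0 u = cm d u"
    using d gm by (simp add: cm_mult_left)
  have duA: "cm d u \<in> A"
    using d(1) by simp
  obtain j where j: "h0 = v [^] (j::nat)"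
    using h by (auto simp: h0_def mem_Y_iff nat_pow_pow mult.commute)
  have cjv: "cj w (v [^] k) = w" if "w \<in> A" for w and k :: nat
  proof (induction k)
    case (Suc k)
    have "cj w v = w"
      using that by (simp add: cj_eq_self_iff)
    then show ?case
      using that Suc by (simp add: cj_by_mult)
  qed (use that in simp)
  have cjh: "cj w h0 = w" if "w \<in> A" for w
    using cjv[OF that] j by simp
  have "cm (h0 [^] k) u = cm d u [^] k" for k :: nat
  proof (induction k)
    case (Suc k)
    then show ?case
      using h0Y duA e cjh by (simp add: cm_mult_left)
  qed auto
  moreover have "h0 [^] m' = \<one>"
    unfolding h0_def using h pow_Y[OF h] g c by (simp add: nat_pow_pow n_eq)
  ultimately have "cm d u [^] m' = \<one>"
    by (metis X_carrier X_pow cm_one(1))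
  then have "cm d u = \<one>"
    using M_pow_eq_one[OF A_M[OF duA]] by simp
  then have "d = \<one>"
    using A_cm_u_eq_one d by blast
  then have "h0 = g [^] m"
    using d g by simp
  then have "h0 = \<one>"
    using h0Y gm eq_one_if_mem_X_Y by metis
  then show "(g \<otimes> c) [^] m = \<one>" "g [^] m = \<one>"
    using \<open>h0 = g [^] m\<close> h0_def by auto
qed

lemma A_subset_Y:
  assumes ex: "\<exists>z\<in>M. cm z u \<noteq> \<one>" and c: "c \<in> A"
  shows "c \<in> YS"
proof -
  interpret sw: isob_prime G n y x p a m' by (rule prime_swapped)
  obtain z where z: "z \<in> M" "cm z v \<noteq> \<one>"
    using swap_moves_M ex by blast
  define b where "b = cm z v"
  have b: "b \<in> sw.A" "b \<noteq> \<one>"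
    using z sw.A_I[of z] by (simp_all add: b_def)
  have bc: "b \<in> carrier G" using z by (simp add: b_def)
  obtain h1 g1 where 1: "h1 \<in> YS" "g1 \<in> XS" "g1 = h1 \<otimes> b"
    using sw.X_inv_Y_factor[OF bc] by blast
  have g1m: "g1 [^] m = \<one>"
    using sw.A_factor(2)[OF b(1), of h1] 1 by auto
  have g1: "g1 \<noteq> \<one>"
  proof
    assume "g1 = \<one>"
    then have "inv h1 = b"
      using 1 bc by (metis Y_carrier inv_equality inv_inv inv_closed)
    then have "b \<in> YS"
      using 1 subgroup.m_inv_closed[OF subgroup_Y] by blast
    then show False using sw.A_X b by blast
  qed
  have cc: "c \<in> carrier G" using c by simp
  obtain g h where gh: "g \<in> XS" "h \<in> YS" "h = g \<otimes> c"
    using X_inv_Y_factor[OF cc] by blast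
  have gv: "cm g v = \<one>" and gm: "g [^] m = \<one>"
    using A_factor[OF c] gh by auto
  have "g = \<one>"
  proof (rule ccontr)
    assume "g \<noteq> \<one>"
    then obtain i j :: nat where ij: "g [^] i = g1 [^] j" "g [^] i \<noteq> \<one>"
      using X_p_elements_meet[of g g1] gh 1 gm g1 g1m by blast
    obtain b' where b': "b' \<in> sw.A" "g1 [^] j = h1 [^] j \<otimes> b'"
      using sw.A_coset_pow[OF b(1), of h1 j] 1 by auto
    have hj: "h1 [^] j \<in> YS"
      using 1 subgroup_pow_mem[OF subgroup_Y] by blast
    have b'M: "b' \<in> M"
      using sw.A_M[OF b'(1)] .
    have "g \<otimes> v = v \<otimes> g"
      using gv gh by (simp add: cm_eq_one_iff)
    then have "g [^] i \<otimes> v = v \<otimes> g [^] i"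
    proof (induction i)
      case (Suc i)
      then have "g [^] i \<otimes> (g \<otimes> v) = v \<otimes> g [^] i \<otimes> g"
        using gh by (simp add: m_assoc [symmetric])
      then show ?case
        using gh by (simp add: m_assoc)
    qed (use gh in simp)
    then have "cm (h1 [^] j \<otimes> b') v = \<one>"
      using ij(1) b'(2) Y_carrier[OF hj] b'M by (simp add: cm_eq_one_iff)
    then have "cm b' v = \<one>"
      using hj b'M by (simp add: cm_mult_left)
    then have "b' = \<one>"
      using sw.A_cm_u_eq_one b' by blast
    then have "g1 [^] j \<in> YS"
      using b' hj by simp
    moreover have "g1 [^] j \<in> XS"
      using 1 subgroup_pow_mem[OF subgroup_X] by blast
    ultimately show False
      using ij eq_one_if_mem_X_Y by metis
  qed
  then show ?thesis using gh c by simp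
qed

lemma Y_pow_m_if_M: assumes "h \<in> YS" "h \<in> M" shows "h [^] m = \<one>"
proof -
  have "ord h dvd m\<^sup>2" "ord h dvd n"
    using assms unfolding M_def by (simp_all add: pow_eq_id [symmetric])
  moreover have "gcd (m\<^sup>2) n = m"
    using coprime_m by (simp add: n_eq power2_eq_square gcd_mult_left coprime_commute)
  ultimately have "ord h dvd m"
    by (metis gcd_greatest)
  then show ?thesis
    using assms by (simp add: pow_eq_id)
qed

lemma A_eq:
  assumes ex: "\<exists>z\<in>M. cm z u \<noteq> \<one>"
  shows "A = {h \<in> YS. h [^] m = \<one>}"
proof -
  let ?P = "{h \<in> YS. h [^] m = \<one>}"
  have sub: "A \<subseteq> ?P"
    using A_subset_Y[OF ex] Y_pow_m_if_M by auto
  define f where "f h = cm (cm h u [^] (m'\<^sup>2)) u" for h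
  have fA: "f h \<in> A" if "h \<in> carrier G" for h
    using that by (simp add: f_def)
  have fmult: "f (h \<otimes> k) = f h \<otimes> f k" if "h \<in> YS" "k \<in> YS" for h k
  proof -
    have "f (h \<otimes> k) = cm (cj (cm h u [^] (m'\<^sup>2)) k \<otimes> cm k u [^] (m'\<^sup>2)) u"
      using that by (simp add: f_def cm_mult_left N_pow_mult cj_pow)
    also have "\<dots> = cj (f h) k \<otimes> f k"
      using that by (simp add: f_def cm_N_mult cm_cj)
    also have "cj (f h) k = f h"
      using that A_subset_Y[OF ex fA] fA by (simp add: cj_eq_self_iff)
    finally show ?thesis .
  qed
  have f1: "f \<one> = \<one>"
    by (simp add: f_def)
  have fpow: "f (h [^] (k::nat)) = f h [^] k" if "h \<in> YS" for h k
    using that subgroup_pow_mem[OF subgroup_Y that] by (induction k) (simp_all add: f1 fmult)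
  obtain a0 where a0: "a0 \<in> A" "a0 \<noteq> \<one>"
    using ex A_I by blast
  have finA: "f c \<noteq> \<one>" if c: "c \<in> A" "c \<noteq> \<one>" for c
  proof
    assume "f c = \<one>"
    then have "cm (cm c u) u [^] (m'\<^sup>2) = \<one>"
      using c by (simp add: f_def cm_N_pow)
    then have "cm (cm c u) u = \<one>"
      using M_pow_sq_eq_one[of "cm (cm c u) u"] c by simp
    then have "c = \<one>"
      using cm_cm_u_eq_one[of c] A_cm_u_eq_one[of c] c by simp
    then show False using c by simp
  qed
  have ker: "h = \<one>" if h: "h \<in> ?P" and fh: "f h = \<one>" for h
  proof (rule ccontr)
    assume "h \<noteq> \<one>"
    then obtain i j :: nat where ij: "h [^] i = a0 [^] j" "h [^] i \<noteq> \<one>"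
      using Y_p_elements_meet[of h a0] h a0 sub by blast
    then have "f (a0 [^] j) = \<one>"
      using fpow[of h i] h fh by simp
    then show False
      using finA[of "a0 [^] j"] a0 ij by simp
  qed
  have Psub: "subgroup ?P G"
  proof (rule subgroupI)
    show "?P \<noteq> {}" using subgroup.one_closed[OF subgroup_Y] by force
  next
    fix g assume "g \<in> ?P"
    then show "inv g \<in> ?P"
      using subgroup.m_inv_closed[OF subgroup_Y] by (simp add: nat_pow_inv)
  next
    fix g h assume "g \<in> ?P" "h \<in> ?P"
    then show "g \<otimes> h \<in> ?P"
      using subgroup.m_closed[OF subgroup_Y] by (simp add: pow_mult_distrib Y_comm)
  qed auto
  have "inj_on f ?P"
  proof (rule inj_onI)
    fix g h assume gh: "g \<in> ?P" "h \<in> ?P" "f g = f h"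
    have d: "g \<otimes> inv h \<in> ?P" and ih: "inv h \<in> ?P"
      using gh subgroup.m_closed[OF Psub] subgroup.m_inv_closed[OF Psub] by blast+
    have hY: "h \<in> YS" and ihY: "inv h \<in> YS" and gY: "g \<in> YS"
      using gh ih by auto
    have "f (g \<otimes> inv h) = f h \<otimes> f (inv h)"
      using gh fmult[OF gY ihY] by simp
    also have "\<dots> = f \<one>"
      using fmult[OF hY ihY] hY by simp
    finally have "g \<otimes> inv h = \<one>"
      using ker[OF d] f1 by simp
    then show "g = h"
      using gY hY inv_solve_right'[of \<one> g h] by simp
  qed
  moreover have "f ` ?P \<subseteq> A" using fA by auto
  moreover have finP: "finite ?P"
    by (rule finite_subset[OF _ finite_G]) auto
  ultimately have "card ?P \<le> card A"
    using card_inj_on_le[of f ?P A] finite_subset[OF sub] by blast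
  then show ?thesis
    by (rule card_seteq[OF finP sub])
qed

lemma active_y_mem_N:
  assumes "\<exists>z\<in>M. cm z u \<noteq> \<one>" shows "y [^] m' \<in> N"
proof -
  have "(y [^] m') [^] m = \<one>"
    by (simp add: nat_pow_pow y_pow_eq_one_iff n_eq mult.commute)
  then have "y [^] m' \<in> A"
    using A_eq[OF assms] by simp
  then show ?thesis by simp
qed

lemma active_y_normal:
  assumes "\<exists>z\<in>M. cm z u \<noteq> \<one>" shows "cj (y [^] m') x \<in> YS"
proof -
  have "(y [^] m') [^] m = \<one>"
    by (simp add: nat_pow_pow y_pow_eq_one_iff n_eq mult.commute)
  then have "y [^] m' \<in> A"
    using A_eq[OF assms] by simp
  then show ?thesis using A_subset_Y[OF assms] by simp
qed

lemma active_cm_mem_Y: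
  assumes "\<exists>z\<in>M. cm z u \<noteq> \<one>" and z: "z \<in> N" shows "cm (z [^] (m'\<^sup>2)) (u [^] (k::nat)) \<in> YS"
proof (induction k)
  case 0
  then show ?case using subgroup.one_closed[OF subgroup_Y] z by simp
next
  case (Suc k)
  define w where "w = z [^] (m'\<^sup>2)"
  have w: "w \<in> M" using z by (simp add: w_def)
  have "cm w (u [^] k) \<in> M" using w by simp
  have IH: "cm w (u [^] k) \<in> YS" using Suc by (simp add: w_def)
  have "cm w (u [^] Suc k) = cm w u \<otimes> cj (cm w (u [^] k)) u"
    using w by (simp add: cm_mult_right)
  moreover have "cm w u \<in> YS"
    using A_subset_Y[OF assms(1)] w by simp
  moreover have "cm w (u [^] k) \<in> A"
    using A_eq[OF assms(1)] IH Y_pow_m_if_M \<open>cm w (u [^] k) \<in> M\<close> by blast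
  then have "cj (cm w (u [^] k)) u \<in> YS"
    using A_subset_Y[OF assms(1)] by simp
  ultimately show ?case
    using subgroup.m_closed[OF subgroup_Y] by (simp add: w_def)
qed

lemma active_fixed_point_free:
  assumes "\<exists>z\<in>M. cm z u \<noteq> \<one>" and h: "h \<in> YS" "h [^] m = \<one>" "cm h u = \<one>" shows "h = \<one>"
  using A_eq[OF assms(1)] A_cm_u_eq_one h by blast

end

section \<open>Normal complements for the inactive primes\<close>

context group
begin

lemma cauchy_subgroup:
  assumes H: "subgroup H G" and fin: "finite H" and p: "Factorial_Ring.prime p" "p dvd card H"
  shows "\<exists>h\<in>H. h \<noteq> \<one> \<and> h [^] (p::nat) = \<one>"
proof -
  interpret H: group "G\<lparr>carrier := H\<rparr>"
    by (rule subgroup_imp_group[OF H])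
  obtain k where "card H = p * k"
    using p(2) by (auto simp: dvd_def)
  then have "order (G\<lparr>carrier := H\<rparr>) = p ^ 1 * k"
    by (simp add: order_def)
  then obtain K where K: "subgroup K (G\<lparr>carrier := H\<rparr>)" "card K = p ^ 1"
    using sylow_thm[of p "G\<lparr>carrier := H\<rparr>" 1 k] p(1) H.group_axioms fin by auto
  have KG: "subgroup K G"
    by (rule incl_subgroup[OF H K(1)])
  interpret K: group "G\<lparr>carrier := K\<rparr>"
    by (rule subgroup_imp_group[OF KG])
  have "card K > 1"
    using K(2) p(1) prime_gt_1_nat by simp
  then obtain h where h: "h \<in> K" "h \<noteq> \<one>"
    by (metis card_le_Suc0_iff_eq card.infinite not_less_eq_eq One_nat_def leD less_nat_zero_code)
  have "h [^]\<^bsub>G\<lparr>carrier := K\<rparr>\<^esub> p = \<one>"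
    using K.pow_order_eq_1[of h] h K(2) by (simp add: order_def)
  then have "h [^] p = \<one>"
    by (simp add: nat_pow_consistent[symmetric])
  moreover have "h \<in> H"
    using subgroup.subset[OF K(1)] h by auto
  ultimately show ?thesis using h by blast
qed

lemma normal_coset_pow:
  assumes K: "K \<lhd> G" and "k \<in> K" "w \<in> carrier G"
  shows "\<exists>k'\<in>K. (k \<otimes> w) [^] (t::nat) = k' \<otimes> w [^] t"
proof (induction t)
  case 0
  show ?case
    using normal_imp_subgroup[OF K] subgroup.one_closed by (intro bexI[of _ \<one>]) auto
next
  case (Suc t)
  note [simp] = subgroup.mem_carrier[OF normal_imp_subgroup[OF K]]
  obtain k' where k': "k' \<in> K" "(k \<otimes> w) [^] t = k' \<otimes> w [^] t"
    using Suc by blast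
  define l where "l = w [^] t \<otimes> k \<otimes> inv (w [^] t)"
  have l: "l \<in> K"
    unfolding l_def using K assms by (simp add: normal.inv_op_closed2)
  have "(k \<otimes> w) [^] Suc t = k' \<otimes> l \<otimes> w [^] Suc t"
    using k' assms by (simp add: l_def group_normalize)
  then show ?case
    using k' l subgroup.m_closed[OF normal_imp_subgroup[OF K]] by blast
qed

lemma normal_extend_cyclic:
  assumes K: "K \<lhd> G" and w: "w \<in> carrier G" and c: "\<And>g. g \<in> carrier G \<Longrightarrow> cm w g \<in> K"
  shows "(K <#> generate G {w}) \<lhd> G"
proof (rule normal_invI)
  note K' = normal_imp_subgroup[OF K]
  note [simp] = subgroup.mem_carrier[OF K']
  let ?L = "K <#> generate G {w}"
  have W: "subgroup (generate G {w}) G"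
    using w by (simp add: generate_is_subgroup)
  show L: "subgroup ?L G"
    by (rule mult_norm_subgroup[OF K W])
  have KL: "k \<in> ?L" if "k \<in> K" for k
    using that subgroup.one_closed[OF W] unfolding set_mult_def by force
  have wL: "w \<in> ?L"
    using subgroup.one_closed[OF K'] generate.incl[of w "{w}" G] w unfolding set_mult_def by force
  fix h g assume h: "h \<in> ?L" and g: "g \<in> carrier G"
  obtain k b where kb: "k \<in> K" "b \<in> generate G {w}" "h = k \<otimes> b"
    using h unfolding set_mult_def by blast
  have b: "b \<in> carrier G" using kb W by (meson subgroup.mem_carrier)
  have cjw: "cj w (inv g) \<in> ?L"
    using cj_eq[of w "inv g"] w g wL KL[OF c] subgroup.m_closed[OF L] by simp
  have "cj b (inv g) \<in> ?L"
    using kb(2)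
  proof induction
    case one
    then show ?case using g subgroup.one_closed[OF L] by simp
  next
    case (incl h)
    then show ?case using cjw by simp
  next
    case (inv h)
    then show ?case using cjw w g subgroup.m_inv_closed[OF L] by (simp add: cj_inv)
  next
    case (eng h1 h2)
    then show ?case
      using g w subgroup.m_closed[OF L] generate_in_carrier[of "{w}"] by (simp add: cj_mult)
  qed
  moreover have "cj k (inv g) \<in> ?L"
    using KL K kb(1) g by (simp add: cj_def normal.inv_op_closed2)
  moreover have "g \<otimes> h \<otimes> inv g = cj k (inv g) \<otimes> cj b (inv g)"
    using kb b g by (simp add: cj_def group_normalize)
  ultimately show "g \<otimes> h \<otimes> inv g \<in> ?L"
    using subgroup.m_closed[OF L] by simp
qed

end

context isob_prime
begin

lemma cm_pow_eq_one_if_trivial: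
  assumes w: "w \<in> carrier G" "w [^] m' = \<one>" and triv: "\<And>z. z \<in> M \<Longrightarrow> cm z w = \<one>" and g: "g \<in> carrier G"
  shows "cm w g [^] (m'\<^sup>2) = \<one>"
proof -
  define z where "z = cm w g [^] (m'\<^sup>2)"
  have z: "z \<in> M" using w g by (simp add: z_def)
  have "cm (w [^] i) g [^] (m'\<^sup>2) = z [^] i" for i :: nat
  proof (induction i)
    case (Suc i)
    have "cm (w [^] Suc i) g [^] (m'\<^sup>2) = cj (cm (w [^] i) g [^] (m'\<^sup>2)) w \<otimes> z"
      using w g by (simp add: cm_mult_left N_pow_mult cj_pow z_def)
    also have "cj (cm (w [^] i) g [^] (m'\<^sup>2)) w = cm (w [^] i) g [^] (m'\<^sup>2)"
      using w g triv[of "cm (w [^] i) g [^] (m'\<^sup>2)"] by (simp add: cj_eq_self_iff)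
    finally show ?case using Suc by simp
  qed (use g in simp)
  from this[of m'] have "z [^] m' = \<one>"
    using w g by simp
  then show ?thesis
    using M_pow_eq_one[OF z] by (simp add: z_def)
qed

lemma normal_xy_multiples:
  assumes inactive: "\<not> (\<exists>z\<in>M. cm z u \<noteq> \<one>)"
  shows "xy_multiples m \<lhd> G"
proof -
  interpret sw: isob_prime G n y x p a m' by (rule prime_swapped)
  have tu: "cm z u = \<one>" if "z \<in> M" for z
    using inactive that by blast
  have tv: "cm z v = \<one>" if "z \<in> M" for z
    using inactive that sw.swap_moves_M by blast
  define K where "K = {z \<in> N. z [^] (m'\<^sup>2) = \<one>}"
  have subK: "subgroup K G"
  proof (rule subgroupI)
    show "K \<noteq> {}" unfolding K_def using N_one by fastforce
  qed (auto simp: K_def nat_pow_inv N_pow_mult)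
  have K: "K \<lhd> G"
  proof (rule normal_invI[OF subK])
    fix g h assume "h \<in> K" "g \<in> carrier G"
    then have "cj h (inv g) \<in> K"
      by (simp add: K_def cj_pow [symmetric])
    then show "g \<otimes> h \<otimes> inv g \<in> K"
      using \<open>g \<in> carrier G\<close> by (simp add: cj_def)
  qed
  have uK: "cm u g \<in> K" and vK: "cm v g \<in> K" if "g \<in> carrier G" for g
    using that cm_pow_eq_one_if_trivial[of u g] cm_pow_eq_one_if_trivial[of v g] u_pow v_pow tu tv
    by (simp_all add: K_def)
  let ?U = "generate G {u}" and ?V = "generate G {v}"
  define L where "L = K <#> ?U"
  have L: "L \<lhd> G"
    unfolding L_def using normal_extend_cyclic[OF K _ uK] by simp
  have U1: "\<one> \<in> ?U" and V1: "\<one> \<in> ?V"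
    by (rule generate.one)+
  have KL: "K \<subseteq> L"
    unfolding L_def set_mult_def using U1 subgroup.mem_carrier[OF subK] by force
  define Q where "Q = L <#> ?V"
  have Q: "Q \<lhd> G"
    unfolding Q_def by (rule normal_extend_cyclic[OF L]) (use vK KL in auto)
  have Qc: "g \<in> carrier G" if "g \<in> Q" for g
    using that normal_imp_subgroup[OF Q] by (meson subgroup.mem_carrier)
  have Upow: "b [^] m' = \<one>" if ab: "b \<in> ?U" for b
  proof -
    obtain i :: nat where "b = u [^] i"
      using ab generate_pow_on_finite_carrier[OF finite_G, of u] by auto
    then show ?thesis
      using u_pow by (metis X_carrier X_pow nat_pow_pow mult.commute nat_pow_one)
  qed
  have Vpow: "b [^] m' = \<one>" if ab: "b \<in> ?V" for b
  proof -
    obtain i :: nat where "b = v [^] i"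
      using ab generate_pow_on_finite_carrier[OF finite_G, of v] by auto
    then show ?thesis
      using v_pow by (metis Y_carrier Y_pow nat_pow_pow mult.commute nat_pow_one)
  qed
  have Qpow: "g [^] (m' ^ 4) = \<one>" if g: "g \<in> Q" for g
  proof -
    obtain l b where lb: "l \<in> L" "b \<in> ?V" "g = l \<otimes> b"
      using g unfolding Q_def set_mult_def by blast
    have bc: "b \<in> carrier G" using lb generate_in_carrier[of "{v}"] by simp
    obtain l' where l': "l' \<in> L" "g [^] m' = l' \<otimes> b [^] m'"
      using normal_coset_pow[OF L lb(1) bc] lb by blast
    have lc': "l' \<in> carrier G"
      using l'(1) normal_imp_subgroup[OF L] by (meson subgroup.mem_carrier)
    then have 1: "g [^] m' = l'"
      using l' Vpow[OF lb(2)] by simp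
    obtain k c where kc: "k \<in> K" "c \<in> ?U" "l' = k \<otimes> c"
      using l' unfolding L_def set_mult_def by blast
    have cc: "c \<in> carrier G" using kc generate_in_carrier[of "{u}"] by simp
    obtain k' where k': "k' \<in> K" "l' [^] m' = k' \<otimes> c [^] m'"
      using normal_coset_pow[OF K kc(1) cc] kc by blast
    then have 2: "l' [^] m' = k'"
      using Upow[OF kc(2)] subgroup.mem_carrier[OF subK] by simp
    have "g [^] (m' ^ 4) = ((g [^] m') [^] m') [^] (m'\<^sup>2)"
      using Qc[OF g] by (simp add: nat_pow_pow power4_eq_xxxx power2_eq_square mult.assoc)
    then show ?thesis
      using 1 2 k' by (simp add: K_def)
  qed
  have subQ: "subgroup Q G" by (rule normal_imp_subgroup[OF Q])
  have finQ: "finite Q" using Qc finite_subset[OF _ finite_G] by blast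
  have "\<not> p dvd card Q"
  proof
    assume "p dvd card Q"
    then obtain h where h: "h \<in> Q" "h \<noteq> \<one>" "h [^] p = \<one>"
      using cauchy_subgroup[OF subQ finQ prime_p] by blast
    have "coprime p (m' ^ 4)"
      using prime_imp_coprime[OF prime_p p_not_dvd] by simp
    then show False
      using h pow_coprime_eq_one[of h p "m' ^ 4"] Qc Qpow by blast
  qed
  then have "coprime (card Q) (m\<^sup>2)"
    using prime_imp_coprime[OF prime_p, of "card Q"] by (simp add: coprime_commute[of "card Q"])
  moreover have "card Q dvd m\<^sup>2 * m'\<^sup>2"
    using lagrange[OF subQ] order_eq by (metis dvd_triv_right n_eq power_mult_distrib)
  ultimately have "card Q dvd m'\<^sup>2"
    using coprime_dvd_mult_right_iff by blast
  moreover have m'0: "m' > 0"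
    using n_pos n_eq by (cases m') auto
  ultimately have cardQ: "card Q \<le> m'\<^sup>2"
    by (simp add: dvd_imp_le)
  have subQ': "xy_multiples m \<subseteq> Q"
  proof
    fix g assume "g \<in> xy_multiples m"
    then obtain i j where "g = x [^] (m * i) \<otimes> y [^] (m * j)"
      unfolding xy_multiples_def by (auto elim!: dvdE)
    then have g: "g = u [^] i \<otimes> v [^] j"
      by (simp add: nat_pow_pow)
    have "u \<in> ?U" "v \<in> ?V" by (auto intro: generate.incl)
    then have "u [^] i \<in> ?U" "v [^] j \<in> ?V"
      by (simp_all add: subgroup_pow_mem generate_is_subgroup)
    moreover have "u [^] i \<in> L"
      unfolding L_def set_mult_def using subgroup.one_closed[OF subK] \<open>u [^] i \<in> ?U\<close> by force
    ultimately show "g \<in> Q"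
      unfolding Q_def set_mult_def g by blast
  qed
  have m0: "m > 0" using prime_p by (simp add: prime_gt_0_nat)
  have "inj_on (\<lambda>(i, j). u [^] i \<otimes> v [^] j) ({..<m'} \<times> {..<m'})"
  proof (rule inj_onI, clarify)
    fix i j k l assume b: "i < m'" "j < m'" "k < m'" "l < m'"
      and e: "u [^] i \<otimes> v [^] j = u [^] k \<otimes> v [^] l"
    have "x [^] (m * i) = x [^] (m * k) \<and> y [^] (m * j) = y [^] (m * l)"
      using X_Y_unique[of "x [^] (m * i)" "x [^] (m * k)" "y [^] (m * j)" "y [^] (m * l)"] e
      by (simp add: nat_pow_pow)
    moreover have "inj_on (\<lambda>i::nat. x [^] i) {0..n - 1}" "inj_on (\<lambda>i::nat. y [^] i) {0..n - 1}"
      using ord_inj[of x] ord_inj[of y] by simp_all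
    moreover have "m * i \<in> {0..n - 1}" "m * j \<in> {0..n - 1}" "m * k \<in> {0..n - 1}" "m * l \<in> {0..n - 1}"
      using b m0 by (simp_all add: n_eq Suc_le_eq less_Suc_eq_le[symmetric] m'0)
    ultimately have "m * i = m * k" "m * j = m * l"
      by (meson inj_onD)+
    then show "i = k \<and> j = l" using m0 by auto
  qed
  moreover have "(\<lambda>(i, j). u [^] i \<otimes> v [^] j) ` ({..<m'} \<times> {..<m'}) \<subseteq> xy_multiples m"
    unfolding xy_multiples_def by (auto simp: nat_pow_pow) (metis dvd_triv_left)
  moreover have finC: "finite (xy_multiples m)" using subQ' finQ finite_subset by blast
  ultimately have "card ({..<m'} \<times> {..<m'}) \<le> card (xy_multiples m)"
    using card_inj_on_le by blast
  then have "card Q \<le> card (xy_multiples m)"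
    using cardQ by (simp add: card_cartesian_product power2_eq_square)
  then have "xy_multiples m = Q"
    using card_seteq[OF finQ subQ'] by simp
  then show ?thesis using Q by simp
qed

end

section \<open>Quotients and discrete logarithms\<close>

context group
begin

lemma pow_cong:
  assumes "z \<in> carrier G" "[i = j] (mod ord z)" shows "z [^] (i::nat) = z [^] (j::nat)"
proof -
  have "int (ord z) dvd int i - int j"
    using assms(2) by (metis cong_int_iff cong_iff_dvd_diff)
  then show ?thesis
    using int_pow_eq[OF assms(1), of "int i" "int j"] by (simp add: int_pow_int dvd_diff_commute)
qed

lemma pow_eq_imp_cong:
  assumes "z \<in> carrier G" "z [^] (i::nat) = z [^] (j::nat)" shows "[i = j] (mod ord z)"
proof -
  have "int (ord z) dvd int i - int j"
    using int_pow_eq[OF assms(1), of "int i" "int j"] assms(2) by (simp add: int_pow_int dvd_diff_commute)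
  then show ?thesis
    by (metis cong_int_iff cong_iff_dvd_diff)
qed

definition dlog :: "'a \<Rightarrow> 'a \<Rightarrow> nat"
  where "dlog z w = (THE i. i < ord z \<and> z [^] i = w)"

lemma dlog_pow:
  assumes "z \<in> carrier G" "ord z > 0" shows "dlog z (z [^] (i::nat)) = i mod ord z"
  unfolding dlog_def
proof (rule the_equality)
  show "i mod ord z < ord z \<and> z [^] (i mod ord z) = z [^] i"
    using assms by (auto intro!: pow_cong simp: cong_def)
next
  fix j assume "j < ord z \<and> z [^] j = z [^] i"
  then show "j = i mod ord z"
    using pow_eq_imp_cong[OF assms(1), of j i] by (simp add: cong_def)
qed

lemma pow_dlog:
  assumes "z \<in> carrier G" "ord z > 0" "w = z [^] (i::nat)" shows "z [^] dlog z w = w"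
  using assms by (auto simp: dlog_pow intro!: pow_cong simp: cong_def)

lemma quotient_copy:
  assumes K: "K \<lhd> G" and fin: "finite (carrier G)"
  obtains H :: "nat monoid" and f where "group H" "f \<in> hom G H" "f ` carrier G = carrier H"
    "\<And>g. g \<in> carrier G \<Longrightarrow> f g = \<one>\<^bsub>H\<^esub> \<longleftrightarrow> g \<in> K"
proof -
  interpret K: normal K G by (rule K)
  interpret Q: group "G Mod K" by (rule K.factorgroup_is_group)
  have "finite (carrier (G Mod K))"
    using fin by (simp add: FactGroup_def RCOSETS_def)
  then obtain c :: "'a set \<Rightarrow> nat" where c: "inj_on c (carrier (G Mod K))"
    using finite_imp_inj_to_nat_seg by blast
  define d where "d = inv_into (carrier (G Mod K)) c"
  have dc: "d (c q) = q" if "q \<in> carrier (G Mod K)" for q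
    using that c by (simp add: d_def)
  define H where "H = \<lparr>carrier = c ` carrier (G Mod K),
      monoid.mult = (\<lambda>a b. c (d a \<otimes>\<^bsub>G Mod K\<^esub> d b)), one = c \<one>\<^bsub>G Mod K\<^esub>\<rparr>"
  have ch: "c \<in> hom (G Mod K) H"
    by (auto simp: hom_def H_def dc)
  have cs: "c ` carrier (G Mod K) = carrier H"
    by (simp add: H_def)
  have "c \<in> iso (G Mod K) H"
    using ch cs c by (simp add: iso_def bij_betw_def)
  then have "group (H\<lparr>one := c \<one>\<^bsub>G Mod K\<^esub>\<rparr>)"
    by (rule Q.iso_imp_img_group)
  then have gH: "group H"
    by (simp add: H_def)
  define f where "f g = c (K #> g)" for g
  have memQ: "K #> g \<in> carrier (G Mod K)" if "g \<in> carrier G" for g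
    using that by (auto simp: FactGroup_def RCOSETS_def)
  have "f \<in> hom G H"
    using hom_compose[OF K.r_coset_hom_Mod ch] by (simp add: f_def[abs_def] hom_def compose_def Pi_iff)
  moreover have "f ` carrier G = carrier H"
    by (auto simp: f_def H_def FactGroup_def RCOSETS_def)
  moreover have "f g = \<one>\<^bsub>H\<^esub> \<longleftrightarrow> g \<in> K" if g: "g \<in> carrier G" for g
  proof -
    have "f g = \<one>\<^bsub>H\<^esub> \<longleftrightarrow> K #> g = \<one>\<^bsub>G Mod K\<^esub>"
      using c memQ[OF g] Q.one_closed by (auto simp: f_def H_def dest: inj_onD)
    also have "\<dots> \<longleftrightarrow> K #> g = K"
      by (simp add: FactGroup_def)
    also have "\<dots> \<longleftrightarrow> g \<in> K"
      using g coset_join1[of K g] coset_join2[of g K] K.is_subgroup by blast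
    finally show ?thesis .
  qed
  ultimately show ?thesis using that gH by blast
qed

end

context isob
begin

lemma swap_involution:
  assumes \<phi>: "\<phi> \<in> iso G G" "\<phi> x = y" "\<phi> y = x" and g: "g \<in> carrier G"
  shows "\<phi> (\<phi> g) = g"
proof -
  interpret \<phi>: group_hom G G \<phi>
    using \<phi>(1) by unfold_locales (simp add: iso_def)
  obtain i j :: nat where "g = x [^] i \<otimes> y [^] j"
    using xy_factor g by blast
  then show ?thesis
    using \<phi> by (simp add: \<phi>.hom_nat_pow)
qed

lemma quotient_isobicyclic:
  assumes H: "group H" and f: "f \<in> hom G H" "f ` carrier G = carrier H"
    and ker: "\<And>g. g \<in> carrier G \<Longrightarrow> f g = \<one>\<^bsub>H\<^esub> \<longleftrightarrow> g \<in> xy_multiples r"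
    and r: "r dvd n"
  shows "isobicyclic r H (f x) (f y)"
proof -
  interpret H: group H by (rule H)
  interpret f: group_hom G H f
    using f(1) by unfold_locales
  have kerxy: "f (x [^] i \<otimes> y [^] j) = \<one>\<^bsub>H\<^esub> \<longleftrightarrow> r dvd i \<and> r dvd j" for i j :: nat
    using ker mem_xy_multiples_iff[OF r] by (simp del: f.hom_mult)
  have kx: "f (x [^] i) = \<one>\<^bsub>H\<^esub> \<longleftrightarrow> r dvd i" and ky: "f (y [^] i) = \<one>\<^bsub>H\<^esub> \<longleftrightarrow> r dvd i" for i :: nat
    using kerxy[of i 0] kerxy[of 0 i] by simp_all
  have ox: "H.ord (f x) = r" and oy: "H.ord (f y) = r"
    using kx ky by (simp_all add: H.ord_unique f.hom_nat_pow [symmetric])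
  have gx: "generate H {f x} = f ` XS" and gy: "generate H {f y} = f ` YS"
    using f.generate_img[of "{x}"] f.generate_img[of "{y}"] by simp_all
  have "carrier H = f ` XS <#>\<^bsub>H\<^esub> f ` YS"
  proof -
    have "f ` (XS <#> YS) = f ` XS <#>\<^bsub>H\<^esub> f ` YS"
      unfolding set_mult_def by force
    then show ?thesis
      using f(2) carrier_eq by simp
  qed
  moreover have "f ` XS \<inter> f ` YS = {\<one>\<^bsub>H\<^esub>}"
  proof -
    have "f a = \<one>\<^bsub>H\<^esub>" if ab: "a \<in> XS" "b \<in> YS" "f a = f b" for a b
    proof -
      obtain i :: nat where i: "a = x [^] i" using ab mem_X_iff by blast
      obtain j :: nat where j: "inv b = y [^] j"
        using ab mem_Y_iff subgroup.m_inv_closed[OF subgroup_Y] by blast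
      have "f (a \<otimes> inv b) = \<one>\<^bsub>H\<^esub>"
        using ab by simp
      then show ?thesis
        using kerxy[of i j] kx i j by (simp del: f.hom_mult)
    qed
    moreover have "\<one>\<^bsub>H\<^esub> \<in> f ` XS \<inter> f ` YS"
      using subgroup.one_closed[OF subgroup_X] subgroup.one_closed[OF subgroup_Y] f.hom_one
      by (metis IntI imageI)
    ultimately show ?thesis by blast
  qed
  moreover have "\<exists>\<theta>. \<theta> \<in> iso H H \<and> \<theta> (f x) = f y \<and> \<theta> (f y) = f x"
  proof -
    obtain \<phi> where \<phi>: "\<phi> \<in> iso G G" "\<phi> x = y" "\<phi> y = x"
      using swap_auto by blast
    interpret \<phi>: group_hom G G \<phi>
      using \<phi>(1) by unfold_locales (simp add: iso_def)
    have pres: "f (\<phi> g) = \<one>\<^bsub>H\<^esub>" if g: "g \<in> carrier G" "f g = \<one>\<^bsub>H\<^esub>" for g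
    proof -
      obtain i j :: nat where ij: "g = x [^] i \<otimes> y [^] j"
        using xy_factor g by blast
      then have "r dvd i" "r dvd j" using kerxy g by auto
      then have "f (y [^] i) = \<one>\<^bsub>H\<^esub>" "f (x [^] j) = \<one>\<^bsub>H\<^esub>" using kx ky by auto
      then show ?thesis
        using ij \<phi> by (simp add: \<phi>.hom_nat_pow)
    qed
    have wd: "f (\<phi> g) = f (\<phi> h)" if gh: "g \<in> carrier G" "h \<in> carrier G" "f g = f h" for g h
    proof -
      have "f (g \<otimes> inv h) = \<one>\<^bsub>H\<^esub>"
        using gh by simp
      then have "f (\<phi> (g \<otimes> inv h)) = \<one>\<^bsub>H\<^esub>"
        by (rule pres[OF m_closed[OF gh(1) inv_closed[OF gh(2)]]])
      then show ?thesis
        using gh H.inv_solve_right'[of "\<one>\<^bsub>H\<^esub>" "f (\<phi> g)" "f (\<phi> h)"] by simp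
    qed
    define \<theta> where "\<theta> h = f (\<phi> (inv_into (carrier G) f h))" for h
    have \<theta>f: "\<theta> (f g) = f (\<phi> g)" if "g \<in> carrier G" for g
      unfolding \<theta>_def using that by (intro wd) (auto simp: inv_into_into f_inv_into_f)
    have hc: "\<exists>g\<in>carrier G. h = f g" if "h \<in> carrier H" for h
      using that f(2) by blast
    have "\<theta> \<in> hom H H"
    proof (rule homI)
      fix h k assume hk: "h \<in> carrier H" "k \<in> carrier H"
      obtain a b where ab: "a \<in> carrier G" "b \<in> carrier G" "h = f a" "k = f b"
        using hc[OF hk(1)] hc[OF hk(2)] by blast
      show "\<theta> (h \<otimes>\<^bsub>H\<^esub> k) = \<theta> h \<otimes>\<^bsub>H\<^esub> \<theta> k"
        using ab \<theta>f[of a] \<theta>f[of b] \<theta>f[of "a \<otimes> b"] by simp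
    next
      fix h assume "h \<in> carrier H"
      then obtain g where "g \<in> carrier G" "h = f g" using hc by blast
      then show "\<theta> h \<in> carrier H" using \<theta>f by simp
    qed
    moreover have inv: "\<theta> (\<theta> h) = h" if h: "h \<in> carrier H" for h
    proof -
      obtain g where "g \<in> carrier G" "h = f g" using hc h by blast
      then show ?thesis
        using \<theta>f swap_involution[OF \<phi>] by simp
    qed
    have "bij_betw \<theta> (carrier H) (carrier H)"
      using \<open>\<theta> \<in> hom H H\<close> inv by (intro bij_betwI[of _ _ _ \<theta>]) (auto simp: hom_def)
    moreover have "\<theta> (f x) = f y" "\<theta> (f y) = f x"
      using \<theta>f \<phi> by simp_all
    ultimately show ?thesis
      unfolding iso_def by blast
  qed
  ultimately show ?thesis
    unfolding isobicyclic_def gx gy ox oy using H f.hom_closed[of x] f.hom_closed[of y] by blast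
qed

end

section \<open>The active part of the group\<close>

lemma gcd_closed_div_prod:
  fixes q :: "'i \<Rightarrow> nat" and n :: nat
  assumes fin: "finite F" and n: "n > 0" and dvd: "prod q F dvd n"
    and cop: "\<And>i j. i \<in> F \<Longrightarrow> j \<in> F \<Longrightarrow> i \<noteq> j \<Longrightarrow> coprime (q i) (q j)"
    and Pn: "P n" and Pq: "\<And>i. i \<in> F \<Longrightarrow> P (n div q i)"
    and Pgcd: "\<And>a b. P a \<Longrightarrow> P b \<Longrightarrow> P (gcd a b)"
  shows "P (n div prod q F)"
  using fin dvd cop Pq
proof (induction F rule: finite_induct)
  case empty
  then show ?case using Pn by simp
next
  case (insert j F)
  have "prod q F dvd n"
    using insert.prems(1) insert.hyps by (simp add: dvd_mult_right)
  then have IH: "P (n div prod q F)"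
    using insert.IH insert.prems by blast
  obtain R where R: "n = q j * prod q F * R"
    using insert.prems(1) insert.hyps by (auto simp: dvd_def)
  have pos: "q j > 0" "prod q F > 0"
    using n R by (auto intro: Nat.gr0I)
  have "coprime (q j) (prod q F)"
    using insert.prems(2) insert.hyps by (intro prod_coprime_right) auto
  then have "gcd (q j) (prod q F) = 1"
    by (simp add: coprime_iff_gcd_eq_1)
  moreover have "n div prod q F = q j * R" "n div q j = prod q F * R" "n div (q j * prod q F) = R"
    using pos by (simp_all add: R mult.assoc mult.left_commute[of "q j"])
  moreover have "gcd (q j * R) (prod q F * R) = gcd (q j) (prod q F) * R"
    by (simp add: gcd_mult_distrib_nat mult.commute[of _ R])
  ultimately have "n div prod q (insert j F) = gcd (n div prod q F) (n div q j)"
    using insert.hyps by simp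
  then show ?case
    using Pgcd[OF IH] insert.prems(3)[of j] by simp
qed

text \<open>The conditions that hold when \<open>t\<close> is the part of \<open>n\<close> made up of the active primes.\<close>

locale isob_split = isob +
  fixes s t :: nat
  assumes n_st: "n = s * t" and coprime_st: "coprime s t"
    and x_s_N: "x [^] s \<in> N" and y_s_N: "y [^] s \<in> N"
    and cj_x_s: "cj (x [^] s) y \<in> XS" and cj_y_s: "cj (y [^] s) x \<in> YS"
    and cm_mem_X: "\<And>z. z \<in> N \<Longrightarrow> cm z (y [^] t) [^] (s\<^sup>2) \<in> XS"
    and cm_mem_Y: "\<And>z. z \<in> N \<Longrightarrow> cm z (x [^] t) [^] (s\<^sup>2) \<in> YS"
    and cm_x_nontrivial: "\<And>p. Factorial_Ring.prime p \<Longrightarrow> p dvd t \<Longrightarrow> cm (x [^] (n div p)) (y [^] t) \<noteq> \<one>"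
    and cm_y_nontrivial: "\<And>p. Factorial_Ring.prime p \<Longrightarrow> p dvd t \<Longrightarrow> cm (y [^] (n div p)) (x [^] t) \<noteq> \<one>"
begin

lemma split_swapped: "isob_split G n y x s t"
proof -
  interpret sw: isob G n y x by (rule swapped)
  show ?thesis
    by unfold_locales
      (fact n_st coprime_st x_s_N y_s_N cj_x_s cj_y_s cm_mem_X cm_mem_Y cm_x_nontrivial cm_y_nontrivial)+
qed

lemma s_pos: "s > 0" and t_pos: "t > 0"
  using n_pos n_st by (auto intro: Nat.gr0I)

lemma X_t_eq:
  assumes "g \<in> XS" "g [^] t = \<one>" shows "\<exists>i::nat. g = (x [^] s) [^] i"
proof -
  obtain k :: nat where k: "g = x [^] k" using assms mem_X_iff by blast
  then have "s * t dvd k * t"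
    using assms(2) x_pow_eq_one_iff[of "k * t"] n_st by (simp add: nat_pow_pow)
  then have "s dvd k" using t_pos by simp
  then show ?thesis using k by (auto simp: nat_pow_pow)
qed

lemma eigenvalue:
  obtains lam :: nat where "cj (x [^] s) y = (x [^] s) [^] lam" "cj (y [^] s) x = (y [^] s) [^] lam"
proof -
  have "cj (x [^] s) y [^] t = \<one>"
    using x_pow_eq_one_iff[of n] by (simp add: cj_pow [symmetric] nat_pow_pow n_st [symmetric])
  then obtain lam :: nat where lam: "cj (x [^] s) y = (x [^] s) [^] lam"
    using X_t_eq[OF cj_x_s] by blast
  obtain \<phi> where \<phi>: "\<phi> \<in> iso G G" "\<phi> x = y" "\<phi> y = x"
    using swap_auto by blast
  interpret \<phi>: group_hom G G \<phi>
    using \<phi>(1) by unfold_locales (simp add: iso_def)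
  have "\<phi> (cj (x [^] s) y) = cj (y [^] s) x"
    using \<phi> by (simp add: cj_def \<phi>.hom_nat_pow)
  moreover have "\<phi> ((x [^] s) [^] lam) = (y [^] s) [^] lam"
    using \<phi> by (simp add: \<phi>.hom_nat_pow)
  ultimately show ?thesis
    using that lam by metis
qed

definition dx :: "'a \<Rightarrow> 'a"
  where "dx g = cm (cm g (y [^] t) [^] (s\<^sup>2)) (y [^] t)"

definition \<alpha> :: 'a
  where "\<alpha> = dx x"

lemma dx_N [simp]: "g \<in> carrier G \<Longrightarrow> dx g \<in> N"
  by (simp add: dx_def)

lemma \<alpha>_N [simp]: "\<alpha> \<in> N"
  by (simp add: \<alpha>_def)

lemma dx_X: "g \<in> carrier G \<Longrightarrow> dx g \<in> XS"
  using cm_mem_X[of "cm g (y [^] t)"] by (simp add: dx_def cm_N_pow)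

lemma dx_pow_t: assumes g: "g \<in> carrier G" shows "dx g [^] t = \<one>"
proof -
  have "dx g [^] (t\<^sup>2) = cm (cm g (y [^] t)) (y [^] t) [^] (n\<^sup>2)"
    using g by (simp add: dx_def cm_N_pow nat_pow_pow n_st power_mult_distrib)
  then have "dx g [^] (t\<^sup>2) = \<one>"
    using g pow_order_N by simp
  moreover have "dx g [^] n = \<one>"
    using dx_X[OF g] by simp
  moreover have "gcd (t\<^sup>2) n = t"
    using coprime_st gcd_mult_distrib_nat[of t t s]
    by (simp add: n_st power2_eq_square mult.commute[of s] coprime_iff_gcd_eq_1 gcd.commute)
  ultimately show ?thesis
    using pow_gcd_mem[OF triv_subgroup, of "dx g" "t\<^sup>2" n] g by simp
qed

lemma dx_mult:
  "g \<in> carrier G \<Longrightarrow> h \<in> carrier G \<Longrightarrow> dx (g \<otimes> h) = cj (dx g) h \<otimes> dx h"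
  by (simp add: dx_def cm_mult_left N_pow_mult cj_pow [symmetric] cm_N_mult cm_cj)

lemma dx_Y: "h \<in> YS \<Longrightarrow> dx h = \<one>"
  by (simp add: dx_def)

lemma cj_dx_X: "g \<in> carrier G \<Longrightarrow> h \<in> XS \<Longrightarrow> cj (dx g) h = dx g"
  using dx_X[of g] by (simp add: cj_eq_self_iff)

lemma dx_x_pow: "dx (x [^] (i::nat)) = \<alpha> [^] i"
proof (induction i)
  case 0
  then show ?case by (simp add: dx_def)
next
  case (Suc i)
  have "cj (dx (x [^] i)) x = dx (x [^] i)"
    by (rule cj_dx_X) (auto intro: generate.incl)
  then show ?case
    using Suc by (simp add: dx_mult \<alpha>_def)
qed

lemma ord_\<alpha>: "ord \<alpha> = t"
proof (rule ccontr)
  assume ne: "ord \<alpha> \<noteq> t"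
  define l where "l = ord \<alpha>"
  have "\<alpha> [^] t = \<one>"
    by (simp add: \<alpha>_def dx_pow_t)
  then have "l dvd t"
    by (simp add: pow_eq_id l_def)
  then obtain c where c: "t = l * c" by blast
  then have "c \<noteq> 1" using ne l_def by auto
  then obtain p where p: "Factorial_Ring.prime p" "p dvd c"
    using prime_factor_nat by blast
  then obtain c' where c': "t = p * (l * c')" using c by (auto simp: dvd_def)
  have p0: "p > 0" using p prime_gt_0_nat by blast
  have pt: "p dvd t" using c' by (rule dvdI)
  define h where "h = x [^] (n div p)"
  have "n = p * (s * (l * c'))"
    unfolding n_st by (subst c') simp
  then have np: "n div p = s * (l * c')" and pn: "p dvd n"
    using p0 by auto
  have hN: "h \<in> N"
    using x_s_N by (simp add: h_def np nat_pow_pow [symmetric])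
  have hp: "h [^] p = \<one>"
    using pn x_pow_eq_one_iff[of n] by (simp add: h_def nat_pow_pow)
  have "dx h = \<alpha> [^] (l * (s * c'))"
    unfolding h_def np dx_x_pow by (simp add: mult.left_commute)
  also have "\<dots> = \<one>"
    by (simp add: pow_eq_id l_def)
  finally have "cm (cm h (y [^] t)) (y [^] t) [^] (s\<^sup>2) = \<one>"
    using hN by (simp add: dx_def cm_N_pow)
  moreover have "cm (cm h (y [^] t)) (y [^] t) [^] p = \<one>"
    using hN hp by (simp add: cm_N_pow [symmetric])
  moreover have cps: "coprime s p"
    using coprime_st pt by (metis coprime_divisors dvd_refl)
  then have "coprime (s\<^sup>2) p" by simp
  ultimately have "cm (cm h (y [^] t)) (y [^] t) = \<one>"
    using pow_coprime_eq_one[of "cm (cm h (y [^] t)) (y [^] t)" "s\<^sup>2" p] hN by simp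
  moreover have "(y [^] t) [^] s = \<one>"
    by (simp add: nat_pow_pow y_pow_eq_one_iff n_st)
  ultimately have "cm h (y [^] t) = \<one>"
    using cm_cm_eq_one[OF hN hp _ _ cps, of "y [^] t"] by simp
  then show False
    using cm_x_nontrivial[OF p(1) pt] by (simp add: h_def)
qed

lemma X_t_eq_\<alpha>: assumes g: "g \<in> XS" "g [^] t = \<one>" shows "\<exists>i::nat. g = \<alpha> [^] i"
proof -
  obtain k :: nat where k: "\<alpha> = (x [^] s) [^] k"
    using X_t_eq[of \<alpha>] dx_X[of x] dx_pow_t[of x] by (auto simp: \<alpha>_def)
  have "coprime k t"
  proof (rule ccontr)
    assume "\<not> coprime k t"
    then have "gcd k t \<noteq> 1" by (simp add: coprime_iff_gcd_eq_1)
    then obtain p where p: "Factorial_Ring.prime p" "p dvd gcd k t"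
      using prime_factor_nat by blast
    then obtain a b where ab: "k = p * a" "t = p * b" by (meson dvd_def gcd_dvd1 gcd_dvd2 dvd_trans)
    have "\<alpha> [^] b = x [^] (s * k * b)"
      unfolding k by (simp add: nat_pow_pow)
    also have "s * k * b = n * a"
      unfolding n_st ab by simp
    finally have "\<alpha> [^] b = x [^] (n * a)" .
    then have "t dvd b"
      using x_pow_eq_one_iff[of "n * a"] ord_\<alpha> pow_eq_id[of \<alpha> b] by simp
    then show False
      using ab t_pos prime_gt_1_nat[OF p(1)] by (auto dest!: dvd_imp_le)
  qed
  then obtain l where l: "[k * l = Suc 0] (mod t)"
    using cong_solve_coprime_nat by blast
  have "ord (x [^] s) = t"
  proof -
    have "(x [^] s) [^] j = \<one> \<longleftrightarrow> t dvd j" for j :: nat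
      using s_pos by (simp add: nat_pow_pow x_pow_eq_one_iff n_st)
    then show ?thesis by (simp add: ord_unique)
  qed
  then have "\<alpha> [^] l = x [^] s"
    using l pow_cong[of "x [^] s" "k * l" "Suc 0"] by (simp add: k nat_pow_pow mult.assoc)
  then show ?thesis
    using X_t_eq[OF g] by (metis \<alpha>_N N_carrier nat_pow_pow)
qed

lemma dx_pow_\<alpha>: "g \<in> carrier G \<Longrightarrow> \<exists>i::nat. dx g = \<alpha> [^] i"
  using X_t_eq_\<alpha> dx_X dx_pow_t by blast

lemma cj_\<alpha>_x: "cj \<alpha> x = \<alpha>"
  using cj_dx_X[of x x] by (simp add: \<alpha>_def generate.incl)

lemma cj_\<alpha>_y:
  assumes "cj (x [^] s) y = (x [^] s) [^] (lam::nat)" shows "cj \<alpha> y = \<alpha> [^] lam"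
proof -
  obtain k :: nat where k: "\<alpha> = (x [^] s) [^] k"
    using X_t_eq[of \<alpha>] dx_X[of x] dx_pow_t[of x] by (auto simp: \<alpha>_def)
  have "cj ((x [^] s) [^] k) y = ((x [^] s) [^] k) [^] lam"
    using assms by (subst cj_pow) (simp_all add: nat_pow_pow mult_ac)
  then show ?thesis by (simp add: k)
qed

lemma cj_\<alpha>_pow: assumes g: "g \<in> carrier G" shows "\<exists>i::nat. cj \<alpha> g = \<alpha> [^] i"
proof -
  obtain lam :: nat where lam: "cj (x [^] s) y = (x [^] s) [^] lam"
    using eigenvalue by blast
  note cy = cj_\<alpha>_y[OF lam]
  obtain i j :: nat where ij: "g = x [^] i \<otimes> y [^] j"
    using xy_factor g by blast
  have "cj \<alpha> (x [^] i) = \<alpha>" for i :: nat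
    by (induction i) (simp_all add: cj_by_mult cj_\<alpha>_x)
  moreover have "\<exists>k::nat. cj \<alpha> (y [^] j) = \<alpha> [^] k" for j :: nat
  proof (induction j)
    case 0
    show ?case by (rule exI[of _ 1]) simp
  next
    case (Suc j)
    then obtain k :: nat where "cj \<alpha> (y [^] j) = \<alpha> [^] k" by blast
    then have "cj \<alpha> (y [^] Suc j) = \<alpha> [^] (lam * k)"
      by (simp add: cj_by_mult cj_pow cy nat_pow_pow)
    then show ?case by blast
  qed
  ultimately show ?thesis
    using ij by (simp add: cj_by_mult)
qed

lemma coprime_eigenvalue:
  assumes "cj (x [^] s) y = (x [^] s) [^] (lam::nat)" shows "coprime lam t"
proof (rule ccontr)
  assume "\<not> coprime lam t"
  then have "gcd lam t \<noteq> 1" by (simp add: coprime_iff_gcd_eq_1)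
  then obtain p where p: "Factorial_Ring.prime p" "p dvd gcd lam t"
    using prime_factor_nat by blast
  then obtain a b where ab: "lam = p * a" "t = p * b" by (meson dvd_def gcd_dvd1 gcd_dvd2 dvd_trans)
  have "cj (\<alpha> [^] b) y = \<alpha> [^] (lam * b)"
    using cj_\<alpha>_y[OF assms] by (simp add: cj_pow nat_pow_pow)
  also have "lam * b = t * a"
    unfolding ab by simp
  also have "\<alpha> [^] (t * a) = \<one>"
    using ord_\<alpha> by (simp add: pow_eq_id)
  finally have "\<alpha> [^] b = \<one>"
    by (simp add: cj_eq_one_iff)
  then have "t dvd b"
    using ord_\<alpha> by (simp add: pow_eq_id)
  then show False
    using ab t_pos prime_gt_1_nat[OF p(1)] by (auto dest!: dvd_imp_le)
qed

end

section \<open>The standard triple\<close>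

lemma std_T_simps [simp]:
  "carrier (std_T t) = {0..<t} \<times> {0..<t}"
  "(a, b) \<otimes>\<^bsub>std_T t\<^esub> (c, d) = ((a + c) mod t, (b + d) mod t)"
  "\<one>\<^bsub>std_T t\<^esub> = (0, 0)"
  by (simp_all add: std_T_def)

lemma group_std_T: assumes "t > 0" shows "group (std_T t)"
proof (rule groupI)
  fix z assume "z \<in> carrier (std_T t)"
  then obtain a b where z: "z = (a, b)" "a < t" "b < t" by auto
  show "\<exists>w\<in>carrier (std_T t). w \<otimes>\<^bsub>std_T t\<^esub> z = \<one>\<^bsub>std_T t\<^esub>"
    using z assms by (intro bexI[of _ "((t - a) mod t, (t - b) mod t)"]) (auto simp: mod_simps)
qed (use assms in \<open>auto simp: mod_simps add.assoc\<close>)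

lemma std_x_pow: "t > 0 \<Longrightarrow> std_x t [^]\<^bsub>std_T t\<^esub> (k::nat) = (k mod t, 0)"
  by (induction k) (auto simp: std_x_def mod_simps)

lemma std_y_pow: "t > 0 \<Longrightarrow> std_y t [^]\<^bsub>std_T t\<^esub> (k::nat) = (0, k mod t)"
  by (induction k) (auto simp: std_y_def mod_simps)

lemma isobicyclic_std_T: assumes t: "t > 0" shows "isobicyclic t (std_T t) (std_x t) (std_y t)"
proof -
  interpret T: group "std_T t" by (rule group_std_T[OF t])
  have x: "std_x t \<in> carrier (std_T t)" and y: "std_y t \<in> carrier (std_T t)"
    using t by (simp_all add: std_x_def std_y_def)
  have fin: "finite (carrier (std_T t))" by simp
  have mods: "\<exists>k. a = k mod t" if "a < t" for a
    using that by (intro exI[of _ a]) simp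
  have gx: "generate (std_T t) {std_x t} = {0..<t} \<times> {0}"
    unfolding T.generate_pow_on_finite_carrier[OF fin x] std_x_pow[OF t] using t mods by auto
  have gy: "generate (std_T t) {std_y t} = {0} \<times> {0..<t}"
    unfolding T.generate_pow_on_finite_carrier[OF fin y] std_y_pow[OF t] using t mods by auto
  have "T.ord (std_x t) = t" "T.ord (std_y t) = t"
    using x y t by (simp_all add: T.ord_unique std_x_pow std_y_pow dvd_eq_mod_eq_0 del: std_T_simps(1))
  moreover have "carrier (std_T t) = ({0..<t} \<times> {0}) <#>\<^bsub>std_T t\<^esub> ({0} \<times> {0..<t})"
    unfolding set_mult_def by auto
  moreover have "(\<lambda>(a, b). (b, a)) \<in> iso (std_T t) (std_T t)"
    by (auto simp: iso_def hom_def bij_betw_def inj_on_def image_def)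
  moreover have "(\<lambda>(a, b). (b, a)) (std_x t) = std_y t" "(\<lambda>(a, b). (b, a)) (std_y t) = std_x t"
    by (simp_all add: std_x_def std_y_def)
  moreover have "({0..<t} \<times> {0}) \<inter> ({0} \<times> {0..<t}) = {\<one>\<^bsub>std_T t\<^esub>}"
    using t by auto
  ultimately show ?thesis
    unfolding isobicyclic_def gx gy using T.group_axioms x y by blast
qed

section \<open>The semidirect decomposition\<close>

context isob_split
begin

lemma xy_multiples_N: "xy_multiples s \<subseteq> N"
  using x_s_N y_s_N by (auto simp: xy_multiples_def nat_pow_pow [symmetric] elim!: dvdE)

lemma semidirect_decomposition:
  assumes S: "group S" and \<rho>: "\<rho> \<in> hom G S" "\<rho> ` carrier G = carrier S"
    and ker: "\<And>g. g \<in> carrier G \<Longrightarrow> \<rho> g = \<one>\<^bsub>S\<^esub> \<longleftrightarrow> g \<in> xy_multiples s"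
  shows "\<exists>\<psi> lam. coprime lam t \<and>
    diagonal_action (std_T t) (std_x t) (std_y t) S (\<rho> x) (\<rho> y) \<psi> lam \<and>
    triple_iso G x y (sdprod (std_T t) S \<psi>) (\<rho> x, std_x t) (\<rho> y, std_y t)"
proof -
  interpret sw: isob_split G n y x s t by (rule split_swapped)
  interpret S: group S by (rule S)
  interpret \<rho>: group_hom G S \<rho> using \<rho>(1) by unfold_locales
  define \<beta> where "\<beta> = sw.\<alpha>"
  define dy where "dy = sw.dx"
  have \<beta>N [simp]: "\<beta> \<in> N" by (simp add: \<beta>_def)
  have ord\<beta>: "ord \<beta> = t" by (simp add: \<beta>_def sw.ord_\<alpha>)
  obtain lam :: nat where lam: "cj (x [^] s) y = (x [^] s) [^] lam" "cj (y [^] s) x = (y [^] s) [^] lam"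
    using eigenvalue by blast
  have \<alpha>y: "cj \<alpha> y = \<alpha> [^] lam" and \<beta>x: "cj \<beta> x = \<beta> [^] lam" and \<beta>y: "cj \<beta> y = \<beta>"
    using cj_\<alpha>_y[OF lam(1)] sw.cj_\<alpha>_y[OF lam(2)] sw.cj_\<alpha>_x by (simp_all add: \<beta>_def)
  have dla: "dlog \<alpha> (\<alpha> [^] i) = i mod t" and dlb: "dlog \<beta> (\<beta> [^] i) = i mod t" for i :: nat
    using dlog_pow[of \<alpha> i] dlog_pow[of \<beta> i] ord_\<alpha> ord\<beta> t_pos by simp_all
  have pa: "\<alpha> [^] dlog \<alpha> w = w" if "\<exists>i::nat. w = \<alpha> [^] i" for w
    using that pow_dlog[of \<alpha> w] ord_\<alpha> t_pos by auto
  have pb: "\<beta> [^] dlog \<beta> w = w" if "\<exists>i::nat. w = \<beta> [^] i" for w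
    using that pow_dlog[of \<beta> w] ord\<beta> t_pos by auto
  define E where "E g = dlog \<alpha> (cj \<alpha> g)" for g
  define E' where "E' g = dlog \<beta> (cj \<beta> g)" for g
  have E: "cj \<alpha> g = \<alpha> [^] E g" and E': "cj \<beta> g = \<beta> [^] E' g" if "g \<in> carrier G" for g
    using pa[OF cj_\<alpha>_pow[OF that]] pb[of "cj \<beta> g"] sw.cj_\<alpha>_pow[OF that]
    by (simp_all add: E_def E'_def \<beta>_def)
  have kerN: "k \<in> N" if "k \<in> carrier G" "\<rho> k = \<one>\<^bsub>S\<^esub>" for k
    using that ker xy_multiples_N by blast
  have cjwd: "cj z g = cj z h" if z: "z \<in> N" and gh: "g \<in> carrier G" "h \<in> carrier G" "\<rho> g = \<rho> h" for z g h
  proof -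
    define k where "k = inv g \<otimes> h"
    have "k \<in> N"
      unfolding k_def using gh by (intro kerN) simp_all
    moreover have "h = g \<otimes> k"
      using gh by (simp add: k_def mult_inv_cancel_left)
    ultimately show ?thesis
      using z gh by (simp add: cj_by_mult)
  qed
  define pre where "pre = inv_into (carrier G) \<rho>"
  have pre: "pre b \<in> carrier G" "\<rho> (pre b) = b" if "b \<in> carrier S" for b
    using that \<rho>(2) by (auto simp: pre_def inv_into_into f_inv_into_f)
  define \<psi> where "\<psi> b = (\<lambda>(i, j). (E (pre b) * i mod t, E' (pre b) * j mod t))" for b
  have \<psi>\<rho>: "\<psi> (\<rho> g) (i, j) = (E g * i mod t, E' g * j mod t)" if g: "g \<in> carrier G" for g i j
    using cjwd[of \<alpha> "pre (\<rho> g)" g] cjwd[of \<beta> "pre (\<rho> g)" g] pre[of "\<rho> g"] g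
    by (simp add: \<psi>_def E_def E'_def)
  have Emult: "E (g \<otimes> h) = E g * E h mod t" "E' (g \<otimes> h) = E' g * E' h mod t"
    if gh: "g \<in> carrier G" "h \<in> carrier G" for g h
  proof -
    have "cj \<alpha> (g \<otimes> h) = \<alpha> [^] (E h * E g)" "cj \<beta> (g \<otimes> h) = \<beta> [^] (E' h * E' g)"
      using gh by (simp_all add: cj_by_mult E E' cj_pow nat_pow_pow)
    then show "E (g \<otimes> h) = E g * E h mod t" "E' (g \<otimes> h) = E' g * E' h mod t"
      by (simp_all add: E_def[of "g \<otimes> h"] E'_def[of "g \<otimes> h"] dla dlb mult.commute)
  qed
  have inj_a: "i = j" if "i < t" "j < t" "\<alpha> [^] i = \<alpha> [^] j" for i j :: nat
    using that by (metis dla mod_less)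
  have inj_b: "i = j" if "i < t" "j < t" "\<beta> [^] i = \<beta> [^] j" for i j :: nat
    using that by (metis dlb mod_less)
  have cj_inj: "w = w'" if "w \<in> carrier G" "w' \<in> carrier G" "g \<in> carrier G" "cj w g = cj w' g" for w w' g
    using that by (simp add: cj_def)
  have Einj: "i = j" if ij: "i < t" "j < t" "E g * i mod t = E g * j mod t" and g: "g \<in> carrier G" for i j g
  proof -
    have "\<alpha> [^] (E g * i) = \<alpha> [^] (E g * j)"
      using ij(3) by (intro pow_cong) (simp_all add: ord_\<alpha> cong_def)
    then have "cj (\<alpha> [^] i) g = cj (\<alpha> [^] j) g"
      using g by (simp add: cj_pow E nat_pow_pow)
    then show ?thesis
      using cj_inj[of "\<alpha> [^] i" "\<alpha> [^] j" g] inj_a[OF ij(1,2)] g by simp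
  qed
  have E'inj: "i = j" if ij: "i < t" "j < t" "E' g * i mod t = E' g * j mod t" and g: "g \<in> carrier G" for i j g
  proof -
    have "\<beta> [^] (E' g * i) = \<beta> [^] (E' g * j)"
      using ij(3) by (intro pow_cong) (simp_all add: ord\<beta> cong_def)
    then have "cj (\<beta> [^] i) g = cj (\<beta> [^] j) g"
      using g by (simp add: cj_pow E' nat_pow_pow)
    then show ?thesis
      using cj_inj[of "\<beta> [^] i" "\<beta> [^] j" g] inj_b[OF ij(1,2)] g by simp
  qed
  have Ssurj: "\<exists>g\<in>carrier G. b = \<rho> g" if "b \<in> carrier S" for b
    using that \<rho>(2) by blast
  have \<psi>iso: "\<psi> b \<in> iso (std_T t) (std_T t)" if b: "b \<in> carrier S" for b
  proof -
    obtain g where g: "g \<in> carrier G" "b = \<rho> g" using Ssurj[OF b] by blast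
    have "\<psi> b \<in> hom (std_T t) (std_T t)"
      using t_pos \<psi>\<rho>[OF g(1)] by (auto intro!: homI simp: g(2) mod_simps distrib_left)
    moreover have inj: "inj_on (\<psi> b) (carrier (std_T t))"
    proof (rule inj_onI)
      fix w z assume wz: "w \<in> carrier (std_T t)" "z \<in> carrier (std_T t)" "\<psi> b w = \<psi> b z"
      obtain i j k l where ijkl: "w = (i, j)" "z = (k, l)" by (cases w, cases z)
      then have lt: "i < t" "j < t" "k < t" "l < t" using wz by auto
      have "E g * i mod t = E g * k mod t" "E' g * j mod t = E' g * l mod t"
        using wz(3) \<psi>\<rho>[OF g(1)] unfolding ijkl g(2) by simp_all
      then have "i = k" "j = l"
        using Einj[OF lt(1,3) _ g(1)] E'inj[OF lt(2,4) _ g(1)] by blast+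
      then show "w = z" by (simp add: ijkl)
    qed
    moreover have "\<psi> b ` carrier (std_T t) = carrier (std_T t)"
      using inj \<open>\<psi> b \<in> hom (std_T t) (std_T t)\<close>
      by (intro endo_inj_surj) (simp, auto simp: hom_def simp del: std_T_simps(1))
    ultimately show ?thesis by (simp add: iso_def bij_betw_def)
  qed
  have \<psi>comp: "\<psi> (b1 \<otimes>\<^bsub>S\<^esub> b2) c = \<psi> b2 (\<psi> b1 c)" if b: "b1 \<in> carrier S" "b2 \<in> carrier S" for b1 b2 c
  proof -
    obtain g1 g2 where g: "g1 \<in> carrier G" "b1 = \<rho> g1" "g2 \<in> carrier G" "b2 = \<rho> g2"
      using Ssurj[OF b(1)] Ssurj[OF b(2)] by blast
    obtain i j where c: "c = (i, j)" by (cases c)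
    have "b1 \<otimes>\<^bsub>S\<^esub> b2 = \<rho> (g1 \<otimes> g2)" using g by simp
    then show ?thesis
      using g \<psi>\<rho>[of "g1 \<otimes> g2" i j] by (simp add: c \<psi>\<rho> Emult mod_simps ac_simps del: \<rho>.hom_mult)
  qed
  have Ex: "E x = 1 mod t" "E' x = lam mod t" "E y = lam mod t" "E' y = 1 mod t"
    using dla[of 1] dlb[of 1] by (simp_all add: E_def E'_def cj_\<alpha>_x \<beta>x \<alpha>y \<beta>y dla dlb)
  have diag: "diagonal_action (std_T t) (std_x t) (std_y t) S (\<rho> x) (\<rho> y) \<psi> lam"
    unfolding diagonal_action_def std_x_pow[OF t_pos] std_y_pow[OF t_pos]
    using \<psi>iso \<psi>comp by (simp add: std_x_def std_y_def \<psi>\<rho> Ex mod_simps)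
  define L where "L g = dlog \<alpha> (dx g)" for g
  define L' where "L' g = dlog \<beta> (dy g)" for g
  have L: "\<alpha> [^] L g = dx g" and L': "\<beta> [^] L' g = dy g" if "g \<in> carrier G" for g
    using pa[OF dx_pow_\<alpha>[OF that]] pb[of "dy g"] sw.dx_pow_\<alpha>[OF that] by (simp_all add: L_def L'_def dy_def \<beta>_def)
  have Lmult: "L (g \<otimes> h) = (E h * L g + L h) mod t" "L' (g \<otimes> h) = (E' h * L' g + L' h) mod t"
    if gh: "g \<in> carrier G" "h \<in> carrier G" for g h
  proof -
    have "dx (g \<otimes> h) = cj (\<alpha> [^] L g) h \<otimes> \<alpha> [^] L h"
      using gh by (simp add: L dx_mult)
    also have "\<dots> = \<alpha> [^] (E h * L g + L h)"
      using gh by (simp add: cj_pow E nat_pow_pow nat_pow_mult)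
    finally show "L (g \<otimes> h) = (E h * L g + L h) mod t"
      by (simp add: L_def[of "g \<otimes> h"] dla)
    have "dy (g \<otimes> h) = cj (\<beta> [^] L' g) h \<otimes> \<beta> [^] L' h"
      using gh by (simp add: L' dy_def sw.dx_mult)
    also have "\<dots> = \<beta> [^] (E' h * L' g + L' h)"
      using gh by (simp add: cj_pow E' nat_pow_pow nat_pow_mult)
    finally show "L' (g \<otimes> h) = (E' h * L' g + L' h) mod t"
      by (simp add: L'_def[of "g \<otimes> h"] dlb)
  qed
  have Llt: "L g < t" "L' g < t" if "g \<in> carrier G" for g
    using Lmult[OF that one_closed] that t_pos by (metis mod_less_divisor r_one)+
  define \<Phi> where "\<Phi> g = (\<rho> g, (L g, L' g))" for g
  have hom: "\<Phi> \<in> hom G (sdprod (std_T t) S \<psi>)"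
    using Llt by (auto intro!: homI simp: \<Phi>_def sdprod_def \<psi>\<rho> Lmult mod_simps)
  have inj: "inj_on \<Phi> (carrier G)"
  proof (rule inj_onI)
    fix g h assume gh: "g \<in> carrier G" "h \<in> carrier G" "\<Phi> g = \<Phi> h"
    define k where "k = inv g \<otimes> h"
    have kc: "k \<in> carrier G" and h: "h = g \<otimes> k"
      using gh by (simp_all add: k_def mult_inv_cancel_left)
    have rk: "\<rho> k = \<one>\<^bsub>S\<^esub>"
      using gh by (simp add: k_def \<Phi>_def)
    have kN: "k \<in> N" using kerN kc rk by blast
    have dd: "dx h = dx g" "dy h = dy g"
      using gh L[of g] L[of h] L'[of g] L'[of h] by (simp_all add: \<Phi>_def)
    have dyN: "dy g \<in> N" "dy k \<in> N"
      using gh(1) kc by (simp_all add: dy_def)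
    have "dx g \<otimes> dx k = dx g \<otimes> \<one>"
      using dd(1) gh(1) kc kN by (simp add: h dx_mult)
    then have k1: "dx k = \<one>"
      using gh(1) kc by (simp del: r_one)
    have "dy g \<otimes> dy k = dy g \<otimes> \<one>"
      using dd(2) gh(1) kc kN dyN by (simp add: h dy_def sw.dx_mult)
    then have k2: "dy k = \<one>"
      using dyN by (simp del: r_one)
    obtain i j :: nat where ij: "k = x [^] i \<otimes> y [^] j" "s dvd i" "s dvd j"
      using ker[OF kc] rk unfolding xy_multiples_def by blast
    have "cj (\<alpha> [^] i) (y [^] j) = \<one>"
      using k1 by (simp add: ij dx_mult dx_x_pow dx_Y)
    then have "\<alpha> [^] i = \<one>"
      by (simp add: cj_eq_one_iff)
    then have "t dvd i"
      by (simp add: pow_eq_id ord_\<alpha>)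
    have "\<beta> [^] j = \<one>"
      using k2 by (simp add: ij dy_def \<beta>_def sw.dx_mult sw.dx_x_pow sw.dx_Y)
    then have "t dvd j"
      by (simp add: pow_eq_id ord\<beta>)
    have "n dvd i" "n dvd j"
      using \<open>t dvd i\<close> \<open>t dvd j\<close> ij coprime_st by (simp_all add: n_st divides_mult)
    then have "k = \<one>"
      by (simp add: ij x_pow_eq_one_iff[THEN iffD2] y_pow_eq_one_iff[THEN iffD2])
    then show "g = h" using h gh by simp
  qed
  have isoS: "isobicyclic s S (\<rho> x) (\<rho> y)"
    by (rule quotient_isobicyclic[OF S \<rho> ker]) (simp_all add: n_st)
  interpret iS: isob S s "\<rho> x" "\<rho> y"
    using isoS s_pos by unfold_locales simp_all
  have cardS: "card (carrier S) = s\<^sup>2"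
    using iS.order_eq by (simp add: order_def)
  have sub: "\<Phi> ` carrier G \<subseteq> carrier (sdprod (std_T t) S \<psi>)"
    using hom by (auto simp: hom_def)
  have "card (carrier (sdprod (std_T t) S \<psi>)) = card (\<Phi> ` carrier G)"
    using card_image[OF inj] order_eq cardS
    by (simp add: sdprod_def card_cartesian_product order_def n_st power_mult_distrib power2_eq_square)
  moreover have "finite (carrier (sdprod (std_T t) S \<psi>))"
    by (simp add: sdprod_def)
  ultimately have "\<Phi> ` carrier G = carrier (sdprod (std_T t) S \<psi>)"
    using sub by (metis card_subset_eq)
  then have "\<Phi> \<in> iso G (sdprod (std_T t) S \<psi>)"
    using hom inj by (simp add: iso_def bij_betw_def)
  moreover have "\<Phi> x = (\<rho> x, std_x t)" "\<Phi> y = (\<rho> y, std_y t)"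
  proof -
    have "dx y = \<one>" "dy x = \<one>"
      by (simp_all add: dx_Y dy_def sw.dx_Y generate.incl)
    moreover have "dx x = \<alpha>" "dy y = \<beta>"
      by (simp_all add: \<alpha>_def dy_def \<beta>_def sw.\<alpha>_def)
    ultimately show "\<Phi> x = (\<rho> x, std_x t)" "\<Phi> y = (\<rho> y, std_y t)"
      using dla[of 0] dla[of 1] dlb[of 0] dlb[of 1]
      by (simp_all add: \<Phi>_def L_def L'_def std_x_def std_y_def)
  qed
  ultimately show ?thesis
    using diag coprime_eigenvalue[OF lam(1)] unfolding triple_iso_def by blast
qed

end


section \<open>Splitting off the active primes\<close>

context isob
begin

abbreviation q :: "nat \<Rightarrow> nat"
  where "q p \<equiv> p ^ multiplicity p n"

lemma isob_prime_factor:
  assumes "p \<in> prime_factors n" shows "isob_prime G n x y p (multiplicity p n) (n div q p)"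
proof unfold_locales
  show p: "Factorial_Ring.prime p"
    using assms by auto
  show "n = q p * (n div q p)"
    by (simp add: multiplicity_dvd)
  show "\<not> p dvd n div q p"
    using n_pos prime_gt_1_nat[OF p] by (intro multiplicity_decompose) auto
qed

definition active :: "nat \<Rightarrow> bool"
  where "active p \<longleftrightarrow> p \<in> prime_factors n \<and>
    (\<exists>z\<in>isob_prime.M G p (multiplicity p n). cm z (x [^] q p) \<noteq> \<one>)"

lemma active_swapped: assumes "active p" shows "isob.active G n y p"
proof -
  interpret P: isob_prime G n x y p "multiplicity p n" "n div q p"
    by (rule isob_prime_factor) (use assms active_def in blast)
  interpret sw: isob G n y x by (rule swapped)
  show ?thesis
    using assms P.swap_moves_M unfolding active_def sw.active_def by blast
qed

lemma coprime_prime_parts: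
  "p \<in> prime_factors n \<Longrightarrow> p' \<in> prime_factors n \<Longrightarrow> p \<noteq> p' \<Longrightarrow> coprime (q p) (q p')"
  by (auto intro!: coprime_power_left_iff[THEN iffD2] coprime_power_right_iff[THEN iffD2] primes_coprime)

lemma active_part:
  assumes F: "F \<subseteq> Collect active" and t: "t = prod q F" and n: "n = s * t" and st: "coprime s t"
  shows "y [^] s \<in> N" "cj (y [^] s) x \<in> YS"
    "\<And>z. z \<in> N \<Longrightarrow> cm z (x [^] t) [^] (s\<^sup>2) \<in> YS"
    "\<And>p. x [^] s \<in> N \<Longrightarrow> Factorial_Ring.prime p \<Longrightarrow> p dvd t \<Longrightarrow> cm (y [^] (n div p)) (x [^] t) \<noteq> \<one>"
proof -
  have Fp: "F \<subseteq> prime_factors n"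
    using F by (auto simp: active_def)
  have fin: "finite F"
    using finite_subset[OF Fp] by simp
  have t0: "t > 0" and s0: "s > 0" and n0: "n > 0"
    using n_pos n by (auto intro: Nat.gr0I)
  have s: "s = n div prod q F"
    unfolding t [symmetric] using t0 by (subst n) simp
  note gcd_closed = gcd_closed_div_prod[OF fin n0, of q, folded s]
  have dvd: "prod q F dvd n"
    unfolding t [symmetric] using n by simp
  have cop: "coprime (q i) (q j)" if "i \<in> F" "j \<in> F" "i \<noteq> j" for i j
    using that Fp coprime_prime_parts by blast
  have loc: "isob_prime G n x y p (multiplicity p n) (n div q p)" if "p \<in> F" for p
    using that Fp isob_prime_factor by blast
  have act: "\<exists>z\<in>isob_prime.M G p (multiplicity p n). cm z (x [^] q p) \<noteq> \<one>" if "p \<in> F" for p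
    using that F by (auto simp: active_def)
  show yN: "y [^] s \<in> N"
  proof (rule gcd_closed[where P = "\<lambda>k. y [^] k \<in> N", OF dvd cop])
    fix p assume p: "p \<in> F"
    interpret P: isob_prime G n x y p "multiplicity p n" "n div q p" by (rule loc[OF p])
    show "y [^] (n div q p) \<in> N"
      by (rule P.active_y_mem_N[OF act[OF p]])
  next
    show "y [^] n \<in> N" using y_pow_eq_one_iff[of n] by simp
  qed (auto intro: pow_gcd_mem[OF subgroup_N])
  have "cj y x [^] s \<in> YS"
  proof (rule gcd_closed[where P = "\<lambda>k. cj y x [^] k \<in> YS", OF dvd cop])
    fix p assume p: "p \<in> F"
    interpret P: isob_prime G n x y p "multiplicity p n" "n div q p" by (rule loc[OF p])
    show "cj y x [^] (n div q p) \<in> YS"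
      using P.active_y_normal[OF act[OF p]] by (simp add: cj_pow)
  next
    have "cj y x [^] n = \<one>"
      using y_pow_eq_one_iff[of n] by (simp add: cj_pow [symmetric])
    then show "cj y x [^] n \<in> YS"
      using subgroup.one_closed[OF subgroup_Y] by simp
  qed (auto intro: pow_gcd_mem[OF subgroup_Y])
  then show "cj (y [^] s) x \<in> YS"
    by (simp add: cj_pow)
  show "cm z (x [^] t) [^] (s\<^sup>2) \<in> YS" if z: "z \<in> N" for z
  proof (rule gcd_closed[where P = "\<lambda>k. cm z (x [^] t) [^] (k\<^sup>2) \<in> YS", OF dvd cop])
    fix p assume p: "p \<in> F"
    interpret P: isob_prime G n x y p "multiplicity p n" "n div q p" by (rule loc[OF p])
    obtain k where k: "t = q p * k"
      using dvd_prodI[OF fin p, of q] t by (auto simp: dvd_def)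
    then show "cm z (x [^] t) [^] ((n div q p)\<^sup>2) \<in> YS"
      using P.active_cm_mem_Y[OF act[OF p] z, of k] z by (simp add: cm_N_pow nat_pow_pow)
  next
    have "cm z (x [^] t) [^] (n\<^sup>2) = \<one>"
      using z pow_order_N by simp
    then show "cm z (x [^] t) [^] (n\<^sup>2) \<in> YS"
      using subgroup.one_closed[OF subgroup_Y] by simp
  next
    fix a b :: nat
    assume "cm z (x [^] t) [^] (a\<^sup>2) \<in> YS" "cm z (x [^] t) [^] (b\<^sup>2) \<in> YS"
    then have "cm z (x [^] t) [^] gcd (a\<^sup>2) (b\<^sup>2) \<in> YS"
      using z by (intro pow_gcd_mem[OF subgroup_Y]) auto
    then show "cm z (x [^] t) [^] ((gcd a b)\<^sup>2) \<in> YS"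
      by (simp add: gcd_exp)
  qed
  show "cm (y [^] (n div p)) (x [^] t) \<noteq> \<one>"
    if xN: "x [^] s \<in> N" and p: "Factorial_Ring.prime p" "p dvd t" for p
  proof
    define h where "h = y [^] (n div p)"
    assume "cm (y [^] (n div p)) (x [^] t) = \<one>"
    then have ht: "cj h (x [^] t) = h"
      by (simp add: h_def cj_eq_self_iff)
    obtain p' where p': "p' \<in> F" "p dvd q p'"
      using p fin t prime_dvd_prod_iff[of F p q] by auto
    then have "p dvd p'" "Factorial_Ring.prime p'"
      using p(1) Fp prime_dvd_power by blast+
    then have pF: "p \<in> F"
      using p(1) p'(1) primes_dvd_imp_eq by blast
    interpret P: isob_prime G n x y p "multiplicity p n" "n div q p" by (rule loc[OF pF])
    obtain c where c: "t = p * c" using p by (auto simp: dvd_def)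
    have p0: "p > 0" using p prime_gt_0_nat by blast
    have "n div p = s * c" using n c p0 by simp
    then have hN: "h \<in> N"
      using yN by (simp add: h_def nat_pow_pow [symmetric])
    have "subgroup {g \<in> carrier G. cj h g = h} G"
    proof (rule subgroupI)
      have "\<one> \<in> {g \<in> carrier G. cj h g = h}" using hN by simp
      then show "{g \<in> carrier G. cj h g = h} \<noteq> {}" by blast
    next
      fix g assume g: "g \<in> {g \<in> carrier G. cj h g = h}"
      then have "cj h (g \<otimes> inv g) = cj h (inv g)"
        using hN by (subst cj_by_mult) auto
      then show "inv g \<in> {g \<in> carrier G. cj h g = h}"
        using g hN by simp
    qed (use hN in \<open>auto simp: cj_by_mult\<close>)
    note C = this
    have "x [^] gcd s t \<in> {g \<in> carrier G. cj h g = h}"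
      by (rule pow_gcd_mem[OF C]) (use xN hN ht in auto)
    then have "x \<in> {g \<in> carrier G. cj h g = h}"
      using st by (simp add: coprime_iff_gcd_eq_1)
    then have "cj h (x [^] q p) = h"
      using subgroup_pow_mem[OF C] by blast
    then have hu: "cm h (x [^] q p) = \<one>"
      using hN by (simp add: cj_eq_self_iff)
    have "p dvd q p"
      using pF Fp by (auto simp: prime_factors_multiplicity)
    then obtain d where d: "q p = p * d" by (auto simp: dvd_def)
    have pn: "p dvd n" using n c by simp
    then have "n div p * q p = n * d"
      using d by simp
    then have hm: "h [^] q p = \<one>"
      by (simp add: h_def nat_pow_pow y_pow_eq_one_iff)
    have "h = \<one>"
      by (rule P.active_fixed_point_free[OF act[OF pF] _ hm hu]) (simp add: h_def)
    then have "n dvd n div p"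
      by (simp add: h_def y_pow_eq_one_iff)
    moreover have "n div p < n" "n div p > 0"
      using n0 p prime_gt_1_nat pn p0 by (auto simp: dvd_div_eq_0_iff intro!: Nat.gr0I)
    ultimately show False
      by (auto dest: dvd_imp_le)
  qed
qed

lemma exists_split:
  obtains s t I where "isob_split G n x y s t" "I \<subseteq> prime_factors n" "s = prod q I"
    "\<And>p. p \<in> I \<Longrightarrow> xy_multiples (q p) \<lhd> G"
proof -
  interpret sw: isob G n y x by (rule swapped)
  define F where "F = Collect active"
  define I where "I = prime_factors n - F"
  define s where "s = prod q I"
  define t where "t = prod q F"
  have Fp: "F \<subseteq> prime_factors n"
    by (auto simp: F_def active_def)
  have "n = prod q (prime_factors n)"
    using prod_prime_factors[of n] n_pos by simp
  also have "prime_factors n = I \<union> F"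
    using Fp by (auto simp: I_def)
  also have "prod q (I \<union> F) = s * t"
    unfolding s_def t_def using Fp finite_subset[OF Fp]
    by (intro prod.union_disjoint) (auto simp: I_def)
  finally have n: "n = s * t" .
  have st: "coprime s t"
    unfolding s_def t_def using Fp
    by (intro prod_coprime_left prod_coprime_right coprime_prime_parts) (auto simp: I_def)
  have F1: "F \<subseteq> Collect active" and F2: "F \<subseteq> Collect sw.active"
    using active_swapped by (auto simp: F_def)
  note ay = active_part[OF F1 t_def n st] and ax = sw.active_part[OF F2 t_def n st]
  have "isob_split G n x y s t"
    by unfold_locales (use n st ax ay in blast)+
  moreover have "xy_multiples (q p) \<lhd> G" if p: "p \<in> I" for p
  proof -
    have pn: "p \<in> prime_factors n" and na: "\<not> active p"
      using p by (auto simp: I_def F_def)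
    interpret P: isob_prime G n x y p "multiplicity p n" "n div q p"
      by (rule isob_prime_factor[OF pn])
    show ?thesis
      by (rule P.normal_xy_multiples) (use na pn active_def in blast)
  qed
  moreover have "I \<subseteq> prime_factors n" by (auto simp: I_def)
  ultimately show ?thesis
    using that s_def by blast
qed

end

theorem theorem4p1:
  fixes n :: nat and G :: "'a monoid" and x y :: 'a
  assumes "n \<ge> 1" and "isobicyclic n G x y"
  shows "\<exists>(s::nat) (t::nat) (k::nat) (p::nat \<Rightarrow> nat) (e::nat \<Rightarrow> nat)
            (Gi :: nat \<Rightarrow> nat monoid) (xi :: nat \<Rightarrow> nat) (yi :: nat \<Rightarrow> nat)
            (\<psi> :: (nat \<Rightarrow> nat) \<Rightarrow> nat \<times> nat \<Rightarrow> nat \<times> nat) (lam::nat).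
           n = s * t \<and> coprime s t \<and>
           s = (\<Prod>i<k. p i ^ e i) \<and> inj_on p {..<k} \<and>
           (\<forall>i<k. Factorial_Ring.prime (p i) \<and> e i \<ge> 1 \<and> isobicyclic (p i ^ e i) (Gi i) (xi i) (yi i)) \<and>
           isobicyclic s (product_group {..<k} Gi) (\<lambda>i\<in>{..<k}. xi i) (\<lambda>i\<in>{..<k}. yi i) \<and>
           isobicyclic t (std_T t) (std_x t) (std_y t) \<and>
           coprime lam t \<and>
           diagonal_action (std_T t) (std_x t) (std_y t)
              (product_group {..<k} Gi) (\<lambda>i\<in>{..<k}. xi i) (\<lambda>i\<in>{..<k}. yi i) \<psi> lam \<and>
           triple_iso G x y (sdprod (std_T t) (product_group {..<k} Gi) \<psi>)
              ((\<lambda>i\<in>{..<k}. xi i), std_x t) ((\<lambda>i\<in>{..<k}. yi i), std_y t)"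
proof -
  have "group G" using assms(2) by (simp add: isobicyclic_def)
  then interpret isob G n x y
    using assms by (intro isob.intro isob_axioms.intro)
  obtain s t I where sp: "isob_split G n x y s t" and I: "I \<subseteq> prime_factors n" and s: "s = prod q I"
    and norm: "\<And>p. p \<in> I \<Longrightarrow> xy_multiples (q p) \<lhd> G"
    using exists_split by blast
  interpret sp: isob_split G n x y s t by (rule sp)
  have finI: "finite I" using finite_subset[OF I] by simp
  define k where "k = card I"
  obtain p where p: "bij_betw p {..<k} I"
    using ex_bij_betw_nat_finite[OF finI] by (auto simp: k_def atLeast0LessThan)
  have pI: "p i \<in> I" if "i < k" for i
    using p that by (auto simp: bij_betw_def)
  have injp: "inj_on p {..<k}"
    using p by (simp add: bij_betw_def)
  define e where "e i = multiplicity (p i) n" for i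
  define r where "r i = p i ^ e i" for i
  have r: "r i = q (p i)" for i by (simp add: r_def e_def)
  have s_prod: "s = (\<Prod>i<k. r i)"
    unfolding s r using prod.reindex_bij_betw[OF p, of q] by simp
  have rn: "r i dvd n" for i
    unfolding r by (rule multiplicity_dvd)
  have pp: "Factorial_Ring.prime (p i)" "e i \<ge> 1" if "i < k" for i
    using pI[OF that] I by (auto simp: prime_factors_multiplicity e_def)
  have cop: "coprime (r i) (r j)" if "i \<in> {..<k}" "j \<in> {..<k}" "i \<noteq> j" for i j
  proof -
    have "p i \<noteq> p j" using injp that by (auto dest: inj_onD)
    then show ?thesis
      unfolding r using coprime_prime_parts pI that I by (meson lessThan_iff subsetD)
  qed
  have "\<exists>(H :: nat monoid) f. group H \<and> f \<in> hom G H \<and> f ` carrier G = carrier H \<and>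
      (\<forall>g\<in>carrier G. f g = \<one>\<^bsub>H\<^esub> \<longleftrightarrow> g \<in> xy_multiples (r i))" if "i < k" for i
    using quotient_copy[OF norm[OF pI[OF that]] finite_G, folded r] by metis
  then obtain Gi :: "nat \<Rightarrow> nat monoid" and f where Gf: "\<And>i. i < k \<Longrightarrow> group (Gi i) \<and> f i \<in> hom G (Gi i) \<and>
      f i ` carrier G = carrier (Gi i) \<and> (\<forall>g\<in>carrier G. f i g = \<one>\<^bsub>Gi i\<^esub> \<longleftrightarrow> g \<in> xy_multiples (r i))"
    by metis
  have iso_i: "isobicyclic (r i) (Gi i) (f i x) (f i y)" if "i < k" for i
    using Gf[OF that] rn by (intro quotient_isobicyclic) auto
  define S where "S = product_group {..<k} Gi"
  define \<rho> where "\<rho> g = (\<lambda>i\<in>{..<k}. f i g)" for g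
  have S: "group S"
    unfolding S_def using Gf by (intro product_group) auto
  have \<rho>hom: "\<rho> \<in> hom G S"
    using Gf by (intro homI) (auto simp: S_def \<rho>_def hom_def Pi_iff intro!: restrict_ext)
  have \<rho>surj: "\<rho> ` carrier G = carrier S"
  proof
    show "\<rho> ` carrier G \<subseteq> carrier S" using \<rho>hom by (auto simp: hom_def)
    show "carrier S \<subseteq> \<rho> ` carrier G"
    proof
      fix b assume b: "b \<in> carrier S"
      have "\<exists>(i::nat) (j::nat). b l = f l (x [^]\<^bsub>G\<^esub> i \<otimes>\<^bsub>G\<^esub> y [^]\<^bsub>G\<^esub> j)" if l: "l < k" for l
      proof -
        have "b l \<in> carrier (Gi l)" using b l by (auto simp: S_def)
        then obtain g where "g \<in> carrier G" "b l = f l g" using Gf[OF l] by (metis imageE)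
        then show ?thesis using xy_factor by metis
      qed
      then obtain u v :: "nat \<Rightarrow> nat" where uv: "\<And>l. l < k \<Longrightarrow> b l = f l (x [^]\<^bsub>G\<^esub> u l \<otimes>\<^bsub>G\<^esub> y [^]\<^bsub>G\<^esub> v l)"
        by metis
      obtain i where i: "\<forall>l\<in>{..<k}. [i = u l] (mod r l)"
        using chinese_remainder_nat[of "{..<k}" r u] cop by auto
      obtain j where j: "\<forall>l\<in>{..<k}. [j = v l] (mod r l)"
        using chinese_remainder_nat[of "{..<k}" r v] cop by auto
      have "b l = f l (x [^]\<^bsub>G\<^esub> i \<otimes>\<^bsub>G\<^esub> y [^]\<^bsub>G\<^esub> j)" if l: "l < k" for l
      proof -
        interpret fl: group_hom G "Gi l" "f l"
          using Gf[OF l] by (intro group_hom.intro group_hom_axioms.intro) auto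
        have "fl.H.ord (f l x) = r l" "fl.H.ord (f l y) = r l"
          using iso_i[OF l] by (auto simp: isobicyclic_def)
        then have "f l x [^]\<^bsub>Gi l\<^esub> i = f l x [^]\<^bsub>Gi l\<^esub> u l" "f l y [^]\<^bsub>Gi l\<^esub> j = f l y [^]\<^bsub>Gi l\<^esub> v l"
          using i j l by (auto intro!: fl.H.pow_cong)
        then show ?thesis
          using uv[OF l] by (simp add: fl.hom_nat_pow)
      qed
      then have "b = \<rho> (x [^]\<^bsub>G\<^esub> i \<otimes>\<^bsub>G\<^esub> y [^]\<^bsub>G\<^esub> j)"
        using b by (auto simp: S_def \<rho>_def PiE_iff extensional_def restrict_def)
      then show "b \<in> \<rho> ` carrier G" by auto
    qed
  qed
  have prod_dvd: "s dvd i \<longleftrightarrow> (\<forall>l<k. r l dvd i)" for i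
  proof
    assume "s dvd i"
    then show "\<forall>l<k. r l dvd i"
      unfolding s_prod using dvd_prodI[of "{..<k}" _ r] by (meson dvd_trans finite_lessThan lessThan_iff)
  next
    assume "\<forall>l<k. r l dvd i"
    then have "[i = 0] (mod (\<Prod>l<k. r l))"
      using cop by (intro coprime_cong_prod_nat) (auto simp: cong_0_iff)
    then show "s dvd i" by (simp add: s_prod cong_0_iff)
  qed
  have sn: "s dvd n" using sp.n_st by simp
  have \<rho>ker: "\<rho> g = \<one>\<^bsub>S\<^esub> \<longleftrightarrow> g \<in> xy_multiples s" if g: "g \<in> carrier G" for g
  proof -
    obtain i j :: nat where ij: "g = x [^]\<^bsub>G\<^esub> i \<otimes>\<^bsub>G\<^esub> y [^]\<^bsub>G\<^esub> j" using xy_factor g by blast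
    have "\<rho> g = \<one>\<^bsub>S\<^esub> \<longleftrightarrow> (\<forall>l<k. f l g = \<one>\<^bsub>Gi l\<^esub>)"
      by (auto simp: \<rho>_def S_def fun_eq_iff)
    also have "\<dots> \<longleftrightarrow> (\<forall>l<k. r l dvd i \<and> r l dvd j)"
      using Gf g mem_xy_multiples_iff[OF rn] by (auto simp: ij)
    also have "\<dots> \<longleftrightarrow> s dvd i \<and> s dvd j"
      using prod_dvd by blast
    also have "\<dots> \<longleftrightarrow> g \<in> xy_multiples s"
      using mem_xy_multiples_iff[OF sn] ij by simp
    finally show ?thesis .
  qed
  have iso_S: "isobicyclic s S (\<rho> x) (\<rho> y)"
    by (rule quotient_isobicyclic[OF S \<rho>hom \<rho>surj \<rho>ker sn])
  obtain \<psi> lam where "coprime lam t"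
    "diagonal_action (std_T t) (std_x t) (std_y t) S (\<rho> x) (\<rho> y) \<psi> lam"
    "triple_iso G x y (sdprod (std_T t) S \<psi>) (\<rho> x, std_x t) (\<rho> y, std_y t)"
    using sp.semidirect_decomposition[OF S \<rho>hom \<rho>surj \<rho>ker] by blast
  moreover have "\<forall>i<k. Factorial_Ring.prime (p i) \<and> e i \<ge> 1 \<and> isobicyclic (p i ^ e i) (Gi i) (f i x) (f i y)"
    using pp iso_i by (simp add: r_def)
  moreover have "s = (\<Prod>i<k. p i ^ e i)"
    using s_prod by (simp add: r_def)
  moreover note sp.n_st sp.coprime_st injp iso_S isobicyclic_std_T[OF sp.t_pos]
  ultimately show ?thesis
    unfolding S_def \<rho>_def
    by - (rule exI[of _ s], rule exI[of _ t], rule exI[of _ k], rule exI[of _ p],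
        rule exI[of _ e], rule exI[of _ Gi], rule exI[of _ "\<lambda>i. f i x"],
        rule exI[of _ "\<lambda>i. f i y"], rule exI[of _ \<psi>], rule exI[of _ lam],
        intro conjI; assumption)
qed

end
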